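(* Let $D$ be the ring of $\mathcal S$-integers of a global field $F$ with $\operatorname{char}(F)\ne2$. Suppose the following (profinite Bateman--Horn conjecture over $D$) holds: for every $k\ge1$ and all pairwise non-associate separable irreducible polynomials $f_1,\dots,f_k\in D[x]$, with product $f$ and associated map $\mathbf f=(f_1,\dots,f_k)$, if $f(\widehat D)\cap\widehat D^*\neq\emptyset$ then the following limits exist and the equalities hold: $$\lim_{\mathfrak n\to0}\widetilde\mu_{\mathbf f|_D^{-1}(\mathcal P(D)^k),\mathfrak n}=\mu_{\mathbf f^{-1}((\widehat D^* )^k)},\qquad \lim_{\mathfrak n\to0}\widetilde\mu_{\mathbf f(D)\cap\mathcal P(D)^k,\mathfrak n}=\mu_{\mathbf f(\widehat D)\cap(\widehat D^* )^k}.$$ Then the following (extended Schinzel's Hypothesis H over $D$) holds: for every $d\ge1$ and all pairwise non-associate separable irreducible polynomials $f_1,\dots,f_d\in D[x]$, with product $f$ and associated map $\mathbf f=(f_1,\dots,f_d)\colon D\to D^d$, if $f(\widehat D)\cap\widehat D^*\neq\emptyset$ then the set $\mathbf f(D)\cap\mathcal P(D)^d$ is infinite.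
   Context: $\mathcal S$ is a nonempty finite set of places of $F$ containing the archimedean ones. $\widehat D=\varprojlim D/\mathfrak n$ over non-zero ideals $\mathfrak n$, with projections $\widehat\pi_{\mathfrak n}\colon\widehat D^m\to(D/\mathfrak n)^m$, unit group $\widehat D^*$, and normalized Haar measure $\mu_{\widehat D^m}$ on $\widehat D^m$; $D\subseteq\widehat D$. $\mathcal P(D)$ is the set of prime elements of $D$ (irreducible $x\in D$ with $xD$ a prime ideal). $\mathbf f$ denotes both $a\mapsto(f_1(a),\dots,f_k(a))$ on $\widehat D$ and its restriction $\mathbf f|_D$ to $D$. For $S\subseteq\widehat D^m$ nonempty let $\widetilde\mu_{S,\mathfrak n}:=\frac{|D/\mathfrak n|^m}{|\widehat\pi_{\mathfrak n}(S)|}\mathbf 1_{\widehat\pi_{\mathfrak n}^{-1}(\widehat\pi_{\mathfrak n}(S))}\cdot\mu_{\widehat D^m}$, and $\widetilde\mu_{\emptyset,\mathfrak n}:=0$. The procounting measure is $\mu_S:=\lim_{\mathfrak n\to0}\widetilde\mu_{S,\mathfrak n}$ (if it exists), the net being indexed by non-zero ideals ordered by divisibility and limits being in the weak-* sense (convergence on every compact open subset of $\widehat D^m$). *)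

theory Defs
  imports "HOL-Analysis.Analysis" "HOL-Algebra.Algebra" "HOL-Algebra.Algebraic_Closure_Type"
begin

section \<open>Global fields, places and rings of S-integers\<close>

abbreviation field_ring :: "'a::field ring" where
  "field_ring \<equiv> ring_of_type_algebra"

text \<open>\<open>generate_field field_ring {}\<close> is the prime field of \<open>'a\<close>.\<close>

definition number_field :: "'a::field itself \<Rightarrow> bool" where
  "number_field _ \<longleftrightarrow> CHAR('a) = 0 \<and>
     ring.finite_dimension (field_ring :: 'a ring) (generate_field field_ring {}) UNIV"

definition global_function_field :: "'a::field itself \<Rightarrow> bool" where
  "global_function_field _ \<longleftrightarrow> CHAR('a) > 0 \<and>
     (\<exists>t::'a. ring.transcendental field_ring (generate_field field_ring {}) t \<and>
        ring.finite_dimension field_ring (generate_field field_ring {t}) UNIV)"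

definition global_field :: "'a::field itself \<Rightarrow> bool" where
  "global_field F \<longleftrightarrow> number_field F \<or> global_function_field F"

definition absolute_value :: "('a::field \<Rightarrow> real) \<Rightarrow> bool" where
  "absolute_value v \<longleftrightarrow>
     (\<forall>x. 0 \<le> v x) \<and> (\<forall>x. v x = 0 \<longleftrightarrow> x = 0) \<and>
     (\<forall>x y. v (x * y) = v x * v y) \<and> (\<forall>x y. v (x + y) \<le> v x + v y)"

definition nontrivial_absolute_value :: "('a::field \<Rightarrow> real) \<Rightarrow> bool" where
  "nontrivial_absolute_value v \<longleftrightarrow> absolute_value v \<and> (\<exists>x. x \<noteq> 0 \<and> v x \<noteq> 1)"

definition equivalent_absolute_values :: "('a::field \<Rightarrow> real) \<Rightarrow> ('a \<Rightarrow> real) \<Rightarrow> bool" where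
  "equivalent_absolute_values v w \<longleftrightarrow> (\<exists>s>0. \<forall>x. w x = v x powr s)"

definition places :: "('a::field \<Rightarrow> real) set set" where
  "places = {{w. nontrivial_absolute_value w \<and> equivalent_absolute_values v w} | v.
               nontrivial_absolute_value v}"

definition archimedean_places :: "('a::field \<Rightarrow> real) set set" where
  "archimedean_places = {P \<in> places. \<exists>v\<in>P. \<not> (\<forall>x y. v (x + y) \<le> max (v x) (v y))}"

definition S_integers :: "('a::field \<Rightarrow> real) set set \<Rightarrow> 'a ring" where
  "S_integers S = field_ring \<lparr>carrier := {x. \<forall>P\<in>places - S. \<forall>v\<in>P. v x \<le> 1}\<rparr>"

section \<open>The profinite completion\<close>

definition nonzero_ideals :: "('a, 'b) ring_scheme \<Rightarrow> 'a set set" where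
  "nonzero_ideals R = {n. ideal n R \<and> n \<noteq> {\<zero>\<^bsub>R\<^esub>}}"

text \<open>The inverse limit of the rings \<open>R Quot n\<close>, as the ring of compatible families of cosets. For
  \<open>n \<subseteq> m\<close> the canonical map \<open>R Quot n \<rightarrow> R Quot m\<close> is \<open>A \<mapsto> m <+>\<^bsub>R\<^esub> A\<close>.\<close>

definition completion :: "('a, 'b) ring_scheme \<Rightarrow> ('a set \<Rightarrow> 'a set) ring" where
  "completion R =
     \<lparr>carrier = {x \<in> (\<Pi>\<^sub>E n\<in>nonzero_ideals R. carrier (R Quot n)).
                  \<forall>n\<in>nonzero_ideals R. \<forall>m\<in>nonzero_ideals R. n \<subseteq> m \<longrightarrow> m <+>\<^bsub>R\<^esub> x n = x m},
      monoid.mult = (\<lambda>x y. \<lambda>n\<in>nonzero_ideals R. x n \<otimes>\<^bsub>R Quot n\<^esub> y n),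
      one = (\<lambda>n\<in>nonzero_ideals R. \<one>\<^bsub>R Quot n\<^esub>),
      ring.zero = (\<lambda>n\<in>nonzero_ideals R. \<zero>\<^bsub>R Quot n\<^esub>),
      add = (\<lambda>x y. \<lambda>n\<in>nonzero_ideals R. x n \<oplus>\<^bsub>R Quot n\<^esub> y n)\<rparr>"

definition completion_embed :: "('a, 'b) ring_scheme \<Rightarrow> 'a \<Rightarrow> 'a set \<Rightarrow> 'a set" where
  "completion_embed R a = (\<lambda>n\<in>nonzero_ideals R. n +>\<^bsub>R\<^esub> a)"

definition completion_topology :: "('a, 'b) ring_scheme \<Rightarrow> ('a set \<Rightarrow> 'a set) topology" where
  "completion_topology R =
     subtopology (product_topology (\<lambda>n. discrete_topology (carrier (R Quot n))) (nonzero_ideals R))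
       (carrier (completion R))"

text \<open>For a set \<open>A\<close>, the power \<open>A\<^sup>m\<close> is \<open>{..<m} \<rightarrow>\<^sub>E A\<close>.\<close>

abbreviation cpow_topology ::
    "('a, 'b) ring_scheme \<Rightarrow> nat \<Rightarrow> (nat \<Rightarrow> 'a set \<Rightarrow> 'a set) topology" where
  "cpow_topology R m \<equiv> product_topology (\<lambda>_. completion_topology R) {..<m}"

definition cpow_embed ::
    "('a, 'b) ring_scheme \<Rightarrow> nat \<Rightarrow> (nat \<Rightarrow> 'a) \<Rightarrow> nat \<Rightarrow> 'a set \<Rightarrow> 'a set" where
  "cpow_embed R m a = (\<lambda>i\<in>{..<m}. completion_embed R (a i))"

definition cpow_proj ::
    "nat \<Rightarrow> 'a set \<Rightarrow> (nat \<Rightarrow> 'a set \<Rightarrow> 'a set) \<Rightarrow> nat \<Rightarrow> 'a set" where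
  "cpow_proj m n x = (\<lambda>i\<in>{..<m}. x i n)"

section \<open>Haar measure and procounting measures\<close>

definition borel_of_topology :: "'x topology \<Rightarrow> 'x measure" where
  "borel_of_topology T = sigma (topspace T) {U. openin T U}"

definition normalized_Haar ::
    "('a, 'b) ring_scheme \<Rightarrow> nat \<Rightarrow> (nat \<Rightarrow> 'a set \<Rightarrow> 'a set) measure \<Rightarrow> bool" where
  "normalized_Haar R m \<mu> \<longleftrightarrow>
     sets \<mu> = sets (borel_of_topology (cpow_topology R m)) \<and>
     emeasure \<mu> (space \<mu>) = 1 \<and>
     (\<forall>a\<in>{..<m} \<rightarrow>\<^sub>E carrier (completion R). \<forall>A\<in>sets \<mu>.
        emeasure \<mu> ((\<lambda>x. \<lambda>i\<in>{..<m}. a i \<oplus>\<^bsub>completion R\<^esub> x i) ` A) = emeasure \<mu> A)"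

text \<open>For a ring of S-integers of a global field the completion is a compact metrizable group, so
  there is exactly one such measure (regularity is automatic) and \<open>SOME\<close> makes no choice.\<close>

definition Haar_measure ::
    "('a, 'b) ring_scheme \<Rightarrow> nat \<Rightarrow> (nat \<Rightarrow> 'a set \<Rightarrow> 'a set) measure" where
  "Haar_measure R m = (SOME \<mu>. normalized_Haar R m \<mu>)"

definition tilde_measure ::
    "('a, 'b) ring_scheme \<Rightarrow> nat \<Rightarrow> (nat \<Rightarrow> 'a set \<Rightarrow> 'a set) set \<Rightarrow> 'a set \<Rightarrow>
     (nat \<Rightarrow> 'a set \<Rightarrow> 'a set) measure" where
  "tilde_measure R m A n =
     (if A = {} then null_measure (Haar_measure R m)
      else density (Haar_measure R m)
        (\<lambda>x. ennreal (real (card (carrier (R Quot n))) ^ m / real (card (cpow_proj m n ` A))) *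
             indicator {y \<in> topspace (cpow_topology R m). cpow_proj m n y \<in> cpow_proj m n ` A} x))"

text \<open>The filter of the net of nonzero ideals ordered by divisibility.\<close>

definition ideals_to_zero :: "('a, 'b) ring_scheme \<Rightarrow> 'a set filter" where
  "ideals_to_zero R =
     (INF n\<in>nonzero_ideals R.
        principal {l \<in> nonzero_ideals R. \<exists>j. ideal j R \<and> l = ideal_prod R n j})"

text \<open>\<open>procounting_measure R m A \<nu>\<close>: the limit of \<open>tilde_measure R m A n\<close> as \<open>n \<rightarrow> 0\<close> exists and
  equals \<open>\<nu>\<close>.\<close>

definition procounting_measure ::
    "('a, 'b) ring_scheme \<Rightarrow> nat \<Rightarrow> (nat \<Rightarrow> 'a set \<Rightarrow> 'a set) set \<Rightarrow>
     (nat \<Rightarrow> 'a set \<Rightarrow> 'a set) measure \<Rightarrow> bool" where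
  "procounting_measure R m A \<nu> \<longleftrightarrow>
     sets \<nu> = sets (borel_of_topology (cpow_topology R m)) \<and>
     (\<forall>C. compactin (cpow_topology R m) C \<and> openin (cpow_topology R m) C \<longrightarrow>
        ((\<lambda>n. emeasure (tilde_measure R m A n) C) \<longlongrightarrow> emeasure \<nu> C) (ideals_to_zero R))"

section \<open>Polynomials and prime elements\<close>

definition prime_elements :: "('a, 'b) ring_scheme \<Rightarrow> 'a set" where
  "prime_elements R =
     {x \<in> carrier R. ring_irreducible\<^bsub>R\<^esub> x \<and> primeideal (PIdl\<^bsub>R\<^esub> x) R}"

text \<open>The ring \<open>R[x]\<close> for a subring \<open>R\<close> of the field \<open>'a\<close>.\<close>

definition polynomials_over :: "'a::field ring \<Rightarrow> 'a poly ring" where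
  "polynomials_over R = ring_of_type_algebra \<lparr>carrier := {p. \<forall>i. poly.coeff p i \<in> carrier R}\<rparr>"

text \<open>No multiple roots in an algebraic closure.\<close>

definition separable_poly :: "'a::field poly \<Rightarrow> bool" where
  "separable_poly f \<longleftrightarrow> rsquarefree (map_poly to_ac f)"

definition poly_completion ::
    "'a::field ring \<Rightarrow> 'a poly \<Rightarrow> ('a set \<Rightarrow> 'a set) \<Rightarrow> 'a set \<Rightarrow> 'a set" where
  "poly_completion R f a =
     (\<Oplus>\<^bsub>completion R\<^esub> i\<in>{..Polynomial.degree f}.
        completion_embed R (poly.coeff f i) \<otimes>\<^bsub>completion R\<^esub> a [^]\<^bsub>completion R\<^esub> i)"

definition poly_map :: "nat \<Rightarrow> (nat \<Rightarrow> 'a::field poly) \<Rightarrow> 'a \<Rightarrow> nat \<Rightarrow> 'a" where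
  "poly_map k f a = (\<lambda>i\<in>{..<k}. poly (f i) a)"

definition poly_map_completion ::
    "'a::field ring \<Rightarrow> nat \<Rightarrow> (nat \<Rightarrow> 'a poly) \<Rightarrow> ('a set \<Rightarrow> 'a set) \<Rightarrow> nat \<Rightarrow> 'a set \<Rightarrow> 'a set" where
  "poly_map_completion R k f a = (\<lambda>i\<in>{..<k}. poly_completion R (f i) a)"

definition admissible_polys :: "'a::field ring \<Rightarrow> nat \<Rightarrow> (nat \<Rightarrow> 'a poly) \<Rightarrow> bool" where
  "admissible_polys R k f \<longleftrightarrow>
     (\<forall>i<k. f i \<in> carrier (polynomials_over R) \<and>
            ring_irreducible\<^bsub>polynomials_over R\<^esub> (f i) \<and> separable_poly (f i)) \<and>
     (\<forall>i<k. \<forall>j<k. i \<noteq> j \<longrightarrow> \<not> f i \<sim>\<^bsub>polynomials_over R\<^esub> f j)"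

definition locally_unit_valued :: "'a::field ring \<Rightarrow> nat \<Rightarrow> (nat \<Rightarrow> 'a poly) \<Rightarrow> bool" where
  "locally_unit_valued R k f \<longleftrightarrow>
     poly_completion R (\<Prod>i<k. f i) ` carrier (completion R) \<inter> Units (completion R) \<noteq> {}"

section \<open>The two conjectures\<close>

text \<open>Subsets of the completion itself are transported to its first power along \<open>a \<mapsto> \<lambda>_\<in>{..<1}. a\<close>.\<close>

definition profinite_Bateman_Horn :: "'a::field ring \<Rightarrow> bool" where
  "profinite_Bateman_Horn R \<longleftrightarrow>
     (\<forall>k\<ge>1. \<forall>f. admissible_polys R k f \<and> locally_unit_valued R k f \<longrightarrow>
        (\<exists>\<nu>. procounting_measure R 1
                ((\<lambda>a. \<lambda>_\<in>{..<1}. completion_embed R a) `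
                   {a \<in> carrier R. poly_map k f a \<in> {..<k} \<rightarrow>\<^sub>E prime_elements R}) \<nu> \<and>
              procounting_measure R 1
                ((\<lambda>a. \<lambda>_\<in>{..<1}. a) `
                   {a \<in> carrier (completion R).
                      poly_map_completion R k f a \<in> {..<k} \<rightarrow>\<^sub>E Units (completion R)}) \<nu>) \<and>
        (\<exists>\<nu>. procounting_measure R k
                (cpow_embed R k `
                   (poly_map k f ` carrier R \<inter> ({..<k} \<rightarrow>\<^sub>E prime_elements R))) \<nu> \<and>
              procounting_measure R k
                (poly_map_completion R k f ` carrier (completion R) \<inter>
                   ({..<k} \<rightarrow>\<^sub>E Units (completion R))) \<nu>))"

definition extended_Schinzel :: "'a::field ring \<Rightarrow> bool" where
  "extended_Schinzel R \<longleftrightarrow>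
     (\<forall>d\<ge>1. \<forall>f. admissible_polys R d f \<and> locally_unit_valued R d f \<longrightarrow>
        infinite (poly_map d f ` carrier R \<inter> ({..<d} \<rightarrow>\<^sub>E prime_elements R)))"

end

(* If f(D) meets P(D)^d in a finite set A, compare the two limits that the second Bateman-Horn
   equality identifies. The set B of tuples of units in f(D^) is nonempty, since a product is a unit
   only if all of its factors are. If A is empty, its limit is 0 while that of B has total mass 1. If
   A contains (p, ...), the limit of A gives mass at least 1/|A| to the clopen set of tuples whose
   first entry is 0 mod p, while B avoids that set already modulo p.

   These computations need a Haar measure on D^, hence finite residue rings D/xD. For x in D nonzero,
   expansions in base x with digits from a set Y of pairwise incongruent elements are distinct, so
   there are |Y|^h of them with h digits. Writing elements of F in coordinates over the fraction field
   of Z or F_p[t], numerators and denominators of such expansions have size at most c L^h with L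
   independent of Y; this bounds |Y|. The argument applies to every subring of F. *)

theory Submission
  imports Defs
begin

section \<open>Invariant measures on profinite spaces\<close>

text \<open>\<open>Haar_measure\<close> is a \<open>SOME\<close> term: nothing is known about it
  until an invariant measure is exhibited. In \<open>tilde_measure\<close>,
  \<open>card (carrier (R Quot n))\<close> is the true index only for finite quotients. Both points
  must be settled before any limit is computed. \<open>profinite_system\<close> abstracts a compact
  space seen through levels \<open>p k\<close> (later: reduction modulo the k-th ideal of a
  decreasing chain) with a transitive set \<open>G\<close> of maps (later: translations).
  Transitivity makes the fibres of a level equally large, so counting classes gives a content;
  compactness makes it countably additive; countability of D supplies a cofinal chain of ideals. For
  finiteness, the obstacle is that the common denominator of the digits depends on Y. Powers remove
  it: with n generators of F, |Y|^h \<le> C * (L^n)^h for all h, where only C depends on Y, forces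
  |Y| \<le> L^n. The finite set A enters through the number of its residue classes, at most |A| at
  every level; this bound does not depend on the level and so survives the limit.\<close>

locale profinite_system =
  fixes T :: "'x topology" and \<Omega> :: "'x set" and p :: "nat \<Rightarrow> 'x \<Rightarrow> 'q" and G :: "('x \<Rightarrow> 'x) set"
  assumes topspace: "topspace T = \<Omega>" and compact: "compact_space T" and nonempty: "\<Omega> \<noteq> {}"
    and openin_fibre: "\<And>k x. x \<in> \<Omega> \<Longrightarrow> openin T {y \<in> \<Omega>. p k y = p k x}"
    and refine: "\<And>k x y. \<lbrakk>x \<in> \<Omega>; y \<in> \<Omega>; p (Suc k) x = p (Suc k) y\<rbrakk> \<Longrightarrow> p k x = p k y"
    and base: "\<And>U x. \<lbrakk>openin T U; x \<in> U\<rbrakk> \<Longrightarrow> \<exists>k. {y \<in> \<Omega>. p k y = p k x} \<subseteq> U"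
    and surj: "\<And>g. g \<in> G \<Longrightarrow> g ` \<Omega> = \<Omega>"
    and equivariant: "\<And>g k x y. \<lbrakk>g \<in> G; x \<in> \<Omega>; y \<in> \<Omega>\<rbrakk> \<Longrightarrow> p k (g x) = p k (g y) \<longleftrightarrow> p k x = p k y"
    and transitive: "\<And>x y. \<lbrakk>x \<in> \<Omega>; y \<in> \<Omega>\<rbrakk> \<Longrightarrow> \<exists>g\<in>G. g x = y"
begin

declare topspace [simp]

definition fibre :: "nat \<Rightarrow> 'x \<Rightarrow> 'x set" where
  "fibre k x = {y \<in> \<Omega>. p k y = p k x}"

definition saturated :: "nat \<Rightarrow> 'x set \<Rightarrow> bool" where
  "saturated k C \<longleftrightarrow> C \<subseteq> \<Omega> \<and> (\<forall>x\<in>C. \<forall>y\<in>\<Omega>. p k y = p k x \<longrightarrow> y \<in> C)"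

definition cylinders :: "'x set set" where
  "cylinders = {C. \<exists>k. saturated k C}"

text \<open>Taking a limit over all levels frees the definition from a choice of level. On a set
  saturated at level \<open>k\<close> the sequence is constant from \<open>k\<close> on
  (\<open>ratio_saturated\<close>), so the limit is attained there.\<close>

definition content :: "'x set \<Rightarrow> real" where
  "content C = lim (\<lambda>k. real (card (p k ` C)) / real (card (p k ` \<Omega>)))"

section \<open>Counting classes level by level\<close>

lemma refine_le:
  assumes "x \<in> \<Omega>" "y \<in> \<Omega>" "p j x = p j y" "k \<le> j"
  shows "p k x = p k y"
  using assms(4,3)
proof (induction rule: dec_induct)
  case (step i)
  show ?case by (rule step.IH[OF refine[OF assms(1,2) step.prems]])
qed simp

lemma saturated_mono:
  assumes "saturated k C" "k \<le> j"
  shows "saturated j C"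
  unfolding saturated_def
proof (intro conjI ballI impI)
  show C: "C \<subseteq> \<Omega>" using assms(1) by (simp add: saturated_def)
  fix x y assume *: "x \<in> C" "y \<in> \<Omega>" "p j y = p j x"
  then have "p k y = p k x" using refine_le[of y x j k] assms(2) C by auto
  then show "y \<in> C" using assms(1) * by (simp add: saturated_def)
qed

lemma finite_range: "finite (p k ` \<Omega>)"
proof -
  have "\<exists>\<F>. finite \<F> \<and> \<F> \<subseteq> fibre k ` \<Omega> \<and> \<Omega> \<subseteq> \<Union>\<F>"
    using compact unfolding compact_space_def topspace
    by (rule compactinD) (auto simp: fibre_def openin_fibre)
  then obtain F where F: "finite F" "F \<subseteq> fibre k ` \<Omega>" "\<Omega> \<subseteq> \<Union>F" by blast
  obtain S where S: "finite S" "S \<subseteq> \<Omega>" "F = fibre k ` S"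
    using finite_subset_image[OF F(1,2)] by blast
  have "p k ` \<Omega> \<subseteq> p k ` S"
  proof
    fix q assume "q \<in> p k ` \<Omega>"
    then obtain x where x: "x \<in> \<Omega>" "q = p k x" by blast
    then obtain y where "y \<in> S" "x \<in> fibre k y" using F(3) unfolding S(3) by blast
    then show "q \<in> p k ` S" using x(2) by (auto simp: fibre_def)
  qed
  then show ?thesis using finite_subset S(1) finite_imageI by metis
qed

lemma card_range_pos: "card (p k ` \<Omega>) > 0"
  using finite_range nonempty by (simp add: card_gt_0_iff)

lemma finite_image: "C \<subseteq> \<Omega> \<Longrightarrow> finite (p k ` C)"
  by (rule finite_subset[OF image_mono finite_range])

text \<open>Some \<open>g\<close> in \<open>G\<close> carries \<open>x\<close> to \<open>y\<close>;
  by equivariance it induces an injection from the level-\<open>j\<close> classes in the fibre of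
  \<open>x\<close> to those in the fibre of \<open>y\<close>. Exchanging \<open>x\<close> and
  \<open>y\<close> gives equality.\<close>

lemma card_fibre:
  assumes x: "x \<in> \<Omega>" and y: "y \<in> \<Omega>"
  shows "card (p j ` fibre k x) = card (p j ` fibre k y)"
proof -
  have le: "card (p j ` fibre k x) \<le> card (p j ` fibre k y)" if x: "x \<in> \<Omega>" and y: "y \<in> \<Omega>" for x y
  proof -
    obtain g where g: "g \<in> G" "g x = y" using transitive x y by blast
    have gX: "g z \<in> \<Omega>" if "z \<in> \<Omega>" for z using surj[OF g(1)] that by blast
    \<comment> \<open>\<open>h\<close> is the action of \<open>g\<close> on level-\<open>j\<close>
      values. It picks a representative of \<open>q\<close>; equivariance makes the result
      independent of the pick.\<close>
    define h where "h q = p j (g (SOME z. z \<in> fibre k x \<and> p j z = q))" for q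
    have h: "h (p j z) = p j (g z)" if z: "z \<in> fibre k x" for z
    proof -
      define z' where "z' = (SOME w. w \<in> fibre k x \<and> p j w = p j z)"
      have "z' \<in> fibre k x \<and> p j z' = p j z" unfolding z'_def by (rule someI) (use z in simp)
      then show ?thesis unfolding h_def z'_def[symmetric] 
        using equivariant[OF g(1)] z by (auto simp: fibre_def)
    qed
    have "inj_on h (p j ` fibre k x)"
      using equivariant[OF g(1)] by (auto simp: inj_on_def h) (auto simp: fibre_def)
    moreover have "h ` p j ` fibre k x \<subseteq> p j ` fibre k y"
    proof safe
      fix z assume z: "z \<in> fibre k x"
      then have "p k (g z) = p k y" using equivariant[OF g(1), of z x] g(2) x by (simp add: fibre_def)
      then show "h (p j z) \<in> p j ` fibre k y" using h[OF z] gX z by (auto simp: fibre_def)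
    qed
    moreover have "finite (p j ` fibre k y)" by (rule finite_image) (auto simp: fibre_def)
    ultimately show ?thesis by (rule card_inj_on_le)
  qed
  show ?thesis using le[OF x y] le[OF y x] by simp
qed

text \<open>The level-\<open>k\<close> fibres partition \<open>C\<close>, values at level
  \<open>j\<close> separate them by refinement, and each contributes the same number by
  \<open>card_fibre\<close>.\<close>

lemma card_saturated:
  assumes x: "x \<in> \<Omega>" and C: "saturated k C" and j: "k \<le> j"
  shows "card (p j ` C) = card (p k ` C) * card (p j ` fibre k x)"
proof -
  define A where "A q = p j ` {z \<in> C. p k z = q}" for q
  have CX: "C \<subseteq> \<Omega>" using C by (simp add: saturated_def)
  have fA: "finite (A q)" for q unfolding A_def by (rule finite_image) (use CX in auto)
  have "card (p j ` C) = card (\<Union>q\<in>p k ` C. A q)"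
    by (rule arg_cong[where f=card]) (auto simp: A_def)
  also have "\<dots> = (\<Sum>q\<in>p k ` C. card (A q))"
  proof (rule card_UN_disjoint)
    show "\<forall>q\<in>p k ` C. \<forall>r\<in>p k ` C. q \<noteq> r \<longrightarrow> A q \<inter> A r = {}"
      using refine_le[OF _ _ _ j] CX unfolding A_def by blast
  qed (use fA finite_image[OF CX] in auto)
  also have "\<dots> = (\<Sum>q\<in>p k ` C. card (p j ` fibre k x))"
  proof (rule sum.cong)
    fix q assume "q \<in> p k ` C"
    then obtain c where c: "c \<in> C" "q = p k c" by blast
    then have "{z \<in> C. p k z = q} = fibre k c" using C by (auto simp: saturated_def fibre_def)
    then show "card (A q) = card (p j ` fibre k x)" using card_fibre[of c x] c CX x unfolding A_def by auto
  qed simp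
  finally show ?thesis by simp
qed

lemma ratio_saturated:
  assumes C: "saturated k C" and j: "k \<le> j"
  shows "real (card (p j ` C)) / real (card (p j ` \<Omega>)) = real (card (p k ` C)) / real (card (p k ` \<Omega>))"
proof -
  obtain x where x: "x \<in> \<Omega>" using nonempty by blast
  have \<Omega>: "saturated k \<Omega>" by (simp add: saturated_def)
  have "card (p j ` fibre k x) \<noteq> 0"
    using card_saturated[OF x \<Omega> j] card_range_pos[of j] by auto
  then show ?thesis using card_saturated[OF x C j] card_saturated[OF x \<Omega> j] by simp
qed

lemma content_saturated:
  assumes "saturated k C"
  shows "content C = real (card (p k ` C)) / real (card (p k ` \<Omega>))"
proof -
  have "\<forall>\<^sub>F j in sequentially. real (card (p j ` C)) / real (card (p j ` \<Omega>)) =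
      real (card (p k ` C)) / real (card (p k ` \<Omega>))"
    using ratio_saturated[OF assms] eventually_sequentially by blast
  from tendsto_eventually[OF this] show ?thesis unfolding content_def by (rule limI)
qed

section \<open>The algebra of cylinders and its finitely additive content\<close>

lemma saturated_Un: "saturated k C \<Longrightarrow> saturated k D \<Longrightarrow> saturated k (C \<union> D)"
  by (auto simp: saturated_def)

lemma saturated_common:
  assumes "C \<in> cylinders" "D \<in> cylinders"
  obtains k where "saturated k C" "saturated k D"
proof -
  obtain j l where "saturated j C" "saturated l D" using assms by (auto simp: cylinders_def)
  then have "saturated (max j l) C" "saturated (max j l) D"
    using saturated_mono[of j C "max j l"] saturated_mono[of l D "max j l"] by auto
  then show ?thesis by (rule that)
qed

lemma algebra_cylinders: "Sigma_Algebra.algebra \<Omega> cylinders"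
proof (unfold algebra_iff_Un, intro conjI ballI)
  show "cylinders \<subseteq> Pow \<Omega>" by (auto simp: cylinders_def saturated_def)
  show "{} \<in> cylinders" by (auto simp: cylinders_def saturated_def)
  fix C assume C: "C \<in> cylinders"
  obtain k where "saturated k C" using C by (auto simp: cylinders_def)
  then have "saturated k (\<Omega> - C)" by (auto simp: saturated_def)
  then show "\<Omega> - C \<in> cylinders" by (auto simp: cylinders_def)
  fix D assume D: "D \<in> cylinders"
  obtain l where "saturated l C" "saturated l D" by (rule saturated_common[OF C D])
  then show "C \<union> D \<in> cylinders" using saturated_Un by (auto simp: cylinders_def)
qed

lemma content_Un:
  assumes "C \<in> cylinders" "D \<in> cylinders" "C \<inter> D = {}"
  shows "content (C \<union> D) = content C + content D"
proof -
  obtain k where k: "saturated k C" "saturated k D" by (rule saturated_common[OF assms(1,2)])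
  have "p k x \<noteq> p k y" if "x \<in> C" "y \<in> D" for x y
    using k that assms(3) unfolding saturated_def by (metis disjoint_iff subsetD)
  then have "p k ` C \<inter> p k ` D = {}" by auto
  then have "card (p k ` (C \<union> D)) = card (p k ` C) + card (p k ` D)"
    using k finite_image[of C k] finite_image[of D k] unfolding image_Un
    by (intro card_Un_disjoint) (auto simp: saturated_def)
  then show ?thesis
    using content_saturated[OF k(1)] content_saturated[OF k(2)] content_saturated[OF saturated_Un[OF k]]
    by (simp add: add_divide_distrib)
qed

lemma content_nonneg: "C \<in> cylinders \<Longrightarrow> 0 \<le> content C"
proof -
  assume "C \<in> cylinders"
  then obtain k where "saturated k C" unfolding cylinders_def by blast
  then have "content C = real (card (p k ` C)) / real (card (p k ` \<Omega>))" by (rule content_saturated)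
  then show ?thesis by simp
qed

lemma openin_saturated:
  assumes "saturated k C"
  shows "openin T C"
proof (subst openin_subopen, intro ballI exI conjI)
  fix x assume x: "x \<in> C"
  then show "openin T {y \<in> \<Omega>. p k y = p k x}"
    using assms by (intro openin_fibre) (auto simp: saturated_def)
  show "x \<in> {y \<in> \<Omega>. p k y = p k x}" "{y \<in> \<Omega>. p k y = p k x} \<subseteq> C"
    using assms x by (auto simp: saturated_def)
qed

text \<open>The complements are open and cover a compact space, so finitely many suffice, and the
  largest index among them already gives the empty set. This is the continuity at the empty set that
  the Caratheodory extension asks for.\<close>

lemma cylinders_decseq_empty:
  assumes A: "range A \<subseteq> cylinders" "decseq A" "(\<Inter>i. A i) = {}"
  shows "\<exists>i. A i = {}"
proof -
  have "\<Omega> - A i \<in> cylinders" for i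
    using A(1) Sigma_Algebra.algebra.compl_sets[OF algebra_cylinders] by blast
  then have op: "openin T (\<Omega> - A i)" for i using openin_saturated by (auto simp: cylinders_def)
  have "\<exists>\<F>. finite \<F> \<and> \<F> \<subseteq> range (\<lambda>i. \<Omega> - A i) \<and> \<Omega> \<subseteq> \<Union>\<F>"
    using compact unfolding compact_space_def topspace
    by (rule compactinD) (use op A(3) in auto)
  then obtain F where F: "finite F" "F \<subseteq> range (\<lambda>i. \<Omega> - A i)" "\<Omega> \<subseteq> \<Union>F" by blast
  obtain I where I: "finite I" "F = (\<lambda>i. \<Omega> - A i) ` I" using finite_subset_image[OF F(1,2)] by blast
  obtain N where N: "\<forall>i\<in>I. i \<le> N" using I(1) finite_nat_set_iff_bounded_le by auto
  have "A N \<subseteq> A i" if "i \<in> I" for i using A(2) N that by (simp add: decseq_def)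
  moreover have "A N \<subseteq> \<Omega>" using A(1) by (auto simp: cylinders_def saturated_def)
  ultimately have "A N = {}" using F(3) I(2) by blast
  then show ?thesis by blast
qed

text \<open>An open set is the union of the cylinders it contains. There are finitely many at each
  level because \<open>p k\<close> has finite range, and the levels are indexed by
  \<open>nat\<close>, so the union is countable.\<close>

lemma sigma_cylinders: "sigma_sets \<Omega> {U. openin T U} = sigma_sets \<Omega> cylinders"
proof (rule sigma_sets_eqI)
  fix U assume "U \<in> {U. openin T U}"
  then have U: "openin T U" by simp
  define R where "R k = {C. saturated k C \<and> C \<subseteq> U}" for k
  have fin: "finite (R k)" for k
  proof -
    have "inj_on (\<lambda>C. p k ` C) (R k)"
    proof (rule inj_onI)
      fix C D assume *: "C \<in> R k" "D \<in> R k" "p k ` C = p k ` D"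
      have "A \<subseteq> B" if "A \<in> R k" "B \<in> R k" "p k ` A = p k ` B" for A B
        using that unfolding R_def saturated_def by (fastforce simp: set_eq_iff image_iff)
      from this[OF *] this[OF *(2,1) *(3)[symmetric]] show "C = D" by blast
    qed
    moreover have "(\<lambda>C. p k ` C) ` R k \<subseteq> Pow (p k ` \<Omega>)" by (auto simp: R_def saturated_def)
    ultimately show ?thesis using finite_range by (meson finite_Pow_iff finite_subset finite_imageD)
  qed
  have U_eq: "U = (\<Union>k. \<Union>(R k))"
  proof
    show "U \<subseteq> (\<Union>k. \<Union>(R k))"
    proof
      fix x assume x: "x \<in> U"
      obtain k where k: "{y \<in> \<Omega>. p k y = p k x} \<subseteq> U" using base[OF U x] by blast
      have "x \<in> \<Omega>" using openin_subset[OF U] x by auto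
      then have "{y \<in> \<Omega>. p k y = p k x} \<in> R k" "x \<in> {y \<in> \<Omega>. p k y = p k x}"
        using k by (auto simp: R_def saturated_def)
      then show "x \<in> (\<Union>k. \<Union>(R k))" by blast
    qed
  qed (auto simp: R_def)
  have "\<Union>(R k) \<in> sigma_sets \<Omega> cylinders" for k
  proof (rule sigma_sets_UNION)
    show "countable (R k)" using fin countable_finite by blast
    show "\<And>b. b \<in> R k \<Longrightarrow> b \<in> sigma_sets \<Omega> cylinders" by (auto simp: R_def cylinders_def intro!: sigma_sets.Basic)
  qed
  then show "U \<in> sigma_sets \<Omega> cylinders" by (subst U_eq) (rule sigma_sets.Union)
next
  fix C assume "C \<in> cylinders"
  then show "C \<in> sigma_sets \<Omega> {U. openin T U}" using openin_saturated by (auto simp: cylinders_def)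
qed

section \<open>Extension to an invariant Borel measure\<close>

lemma saturated_image:
  assumes g: "g \<in> G" and C: "saturated k C"
  shows "saturated k (g ` C)" "card (p k ` g ` C) = card (p k ` C)"
proof -
  have gX: "g z \<in> \<Omega>" if "z \<in> \<Omega>" for z using surj[OF g] that by blast
  have CX: "C \<subseteq> \<Omega>" using C by (simp add: saturated_def)
  show "saturated k (g ` C)"
    unfolding saturated_def
  proof (intro conjI ballI impI)
    show "g ` C \<subseteq> \<Omega>" using CX gX by blast
    fix x y assume x: "x \<in> g ` C" and y: "y \<in> \<Omega>" and e: "p k y = p k x"
    obtain c z where c: "c \<in> C" "x = g c" "z \<in> \<Omega>" "y = g z" using x y surj[OF g] by blast
    have "p k z = p k c" using equivariant[OF g, of z c] c e CX by blast
    then show "y \<in> g ` C" using c C by (auto simp: saturated_def)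
  qed
  define h where "h q = p k (g (SOME z. z \<in> C \<and> p k z = q))" for q
  have h: "h (p k z) = p k (g z)" if z: "z \<in> C" for z
  proof -
    define z' where "z' = (SOME w. w \<in> C \<and> p k w = p k z)"
    have "z' \<in> C \<and> p k z' = p k z" unfolding z'_def by (rule someI) (use z in simp)
    then show ?thesis unfolding h_def z'_def[symmetric] using equivariant[OF g] z CX by blast
  qed
  have "inj_on h (p k ` C)"
    unfolding inj_on_def using equivariant[OF g] CX by (auto simp: h)
  moreover have "h ` p k ` C = p k ` g ` C" using h by (auto simp: image_iff)
  ultimately show "card (p k ` g ` C) = card (p k ` C)" by (metis card_image)
qed

theorem invariant_measure_exists:
  "\<exists>\<mu>. sets \<mu> = sets (borel_of_topology T) \<and> emeasure \<mu> (space \<mu>) = 1 \<and>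
      (\<forall>g\<in>G. inj_on g \<Omega> \<longrightarrow> (\<forall>A\<in>sets \<mu>. emeasure \<mu> (g ` A) = emeasure \<mu> A))"
proof -
  interpret cyl: Sigma_Algebra.algebra \<Omega> cylinders by (rule algebra_cylinders)
  have "\<exists>\<mu>. (\<forall>C\<in>cylinders. \<mu> C = ennreal (content C)) \<and> measure_space \<Omega> (sigma_sets \<Omega> cylinders) \<mu>"
  proof (rule cyl.caratheodory_empty_continuous)
    show "positive cylinders (\<lambda>C. ennreal (content C))"
      using content_saturated[of 0 "{}"] by (simp add: positive_def saturated_def)
    show "additive cylinders (\<lambda>C. ennreal (content C))"
      by (auto simp: additive_def content_Un content_nonneg)
    fix A :: "nat \<Rightarrow> 'x set" assume A: "range A \<subseteq> cylinders" "decseq A" "(\<Inter>i. A i) = {}"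
    then obtain N where "A N = {}" using cylinders_decseq_empty by blast
    then have "A i = {}" if "N \<le> i" for i using A(2) that unfolding decseq_def by blast
    moreover have "content {} = 0" using content_saturated[of 0 "{}"] by (simp add: saturated_def)
    ultimately have "ennreal (content (A i)) = 0" if "N \<le> i" for i using that by simp
    then show "(\<lambda>i. ennreal (content (A i))) \<longlonglongrightarrow> 0"
      by (intro tendsto_eventually eventually_sequentiallyI)
  qed simp
  then obtain m where m: "\<And>C. C \<in> cylinders \<Longrightarrow> m C = ennreal (content C)"
    and ms: "measure_space \<Omega> (sigma_sets \<Omega> cylinders) m" by blast
  define \<mu> where "\<mu> = measure_of \<Omega> cylinders m"
  have sub: "cylinders \<subseteq> Pow \<Omega>" by (rule cyl.space_closed)
  have sets: "sets \<mu> = sigma_sets \<Omega> cylinders" and sp: "space \<mu> = \<Omega>"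
    unfolding \<mu>_def using sub by (simp_all add: sets_measure_of space_measure_of)
  have em: "emeasure \<mu> A = m A" if "A \<in> sigma_sets \<Omega> cylinders" for A
    by (rule emeasure_measure_of[OF \<mu>_def sub])
       (use ms that in \<open>simp_all add: sets measure_space_def\<close>)
  have emC: "emeasure \<mu> C = ennreal (content C)" if "C \<in> cylinders" for C
    using em[of C] m that by (auto intro: sigma_sets.Basic)
  have sat_space: "saturated k \<Omega>" for k by (simp add: saturated_def)
  have e1: "emeasure \<mu> (space \<mu>) = 1"
    unfolding sp 
    using emC[of \<Omega>] content_saturated[OF sat_space, of 0] card_range_pos[of 0] sat_space
    by (auto simp: cylinders_def)
  have inv: "emeasure \<mu> (g ` A) = emeasure \<mu> A" if g: "g \<in> G" "inj_on g \<Omega>" and A: "A \<in> sets \<mu>" for g A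
  proof -
    define h where "h = inv_into \<Omega> g"
    have vim: "h -` A \<inter> \<Omega> = g ` A" if "A \<subseteq> \<Omega>" for A
      using that g(2) surj[OF g(1)] unfolding h_def
      by (auto simp: inv_into_f_f) (metis f_inv_into_f image_eqI)
    have hX: "h \<in> \<Omega> \<rightarrow> \<Omega>" unfolding h_def using surj[OF g(1)] by (auto intro: inv_into_into)
    have gC: "g ` C \<in> cylinders \<and> content (g ` C) = content C" if "C \<in> cylinders" for C
    proof -
      from that obtain k where k: "saturated k C" by (auto simp: cylinders_def)
      have "saturated k (g ` C)" "card (p k ` g ` C) = card (p k ` C)"
        using saturated_image[OF g(1) k] by blast+
      then show ?thesis
        using content_saturated[OF k] content_saturated[of k "g ` C"] by (auto simp: cylinders_def)
    qed
    have meas: "h \<in> measurable \<mu> \<mu>"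
    proof (rule measurable_sigma_sets[OF sets sub])
      show "h \<in> space \<mu> \<rightarrow> \<Omega>" using hX sp by simp
      fix C assume C: "C \<in> cylinders"
      then have "h -` C \<inter> \<Omega> = g ` C" using vim sub by blast
      then show "h -` C \<inter> space \<mu> \<in> sets \<mu>" using gC[OF C] sp sets by (auto intro: sigma_sets.Basic)
    qed
    have "\<mu> = distr \<mu> \<mu> h"
    \<comment> \<open>The cylinders are stable under intersection and generate, so it is enough to
      compare contents there, where \<open>saturated_image\<close> shows that \<open>g\<close>
      preserves the counts.\<close>
    proof (rule measure_eqI_generator_eq[where \<Omega>="\<Omega>" and E=cylinders and A="\<lambda>_. \<Omega>"])
      show "Int_stable cylinders" using cyl.Int by (auto simp: Int_stable_def)
      show "emeasure \<mu> C = emeasure (distr \<mu> \<mu> h) C" if C: "C \<in> cylinders" for C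
      proof -
        have "emeasure (distr \<mu> \<mu> h) C = emeasure \<mu> (h -` C \<inter> space \<mu>)"
          using meas C sets by (intro emeasure_distr) (auto intro: sigma_sets.Basic)
        also have "\<dots> = emeasure \<mu> (g ` C)" using vim[of C] C sub sp by auto
        finally show ?thesis using emC gC C by simp
      qed
      show "range (\<lambda>_. \<Omega>) \<subseteq> cylinders" by auto
      show "emeasure \<mu> \<Omega> \<noteq> \<infinity>" for i :: nat using e1 sp by simp
    qed (use sub sets in auto)
    then have "emeasure \<mu> A = emeasure (distr \<mu> \<mu> h) A" by simp
    also have "\<dots> = emeasure \<mu> (h -` A \<inter> space \<mu>)" using meas A by (intro emeasure_distr) auto
    also have "h -` A \<inter> space \<mu> = g ` A" using vim sp A sets.sets_into_space by blast
    finally show ?thesis by simp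
  qed
  have "sets \<mu> = sets (borel_of_topology T)"
    unfolding sets borel_of_topology_def sigma_cylinders[symmetric]
    using openin_subset[of T] by (subst sets_measure_of) auto
  then show ?thesis using e1 inv by blast
qed

end

section \<open>Finiteness of residue rings in global fields\<close>

text \<open>\<open>A N\<close> stands for the elements of size at most \<open>N\<close> in the image
  of the integers or of F_p[t]. The number of such elements grows linearly in \<open>N\<close>,
  while sizes are subadditive and submultiplicative.\<close>

locale filtered_subring =
  fixes A :: "nat \<Rightarrow> 'a::field set" and c :: nat
  assumes finite: "finite (A N)"
    and card_le: "1 \<le> N \<Longrightarrow> card (A N) \<le> c * N"
    and mono: "M \<le> N \<Longrightarrow> A M \<subseteq> A N"
    and zero_mem: "0 \<in> A N"
    and one_mem: "1 \<in> A 1"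
    and uminus: "a \<in> A N \<Longrightarrow> - a \<in> A N"
    and add: "a \<in> A M \<Longrightarrow> b \<in> A N \<Longrightarrow> a + b \<in> A (M + N)"
    and mult: "a \<in> A M \<Longrightarrow> b \<in> A N \<Longrightarrow> a * b \<in> A (M * N)"

section \<open>Elements of bounded height in a finite-dimensional extension\<close>

locale filtered_lattice = filtered_subring A c for A :: "nat \<Rightarrow> 'a::field set" and c +
  fixes n :: nat and e :: "nat \<Rightarrow> 'a"
  assumes spanning: "\<exists>N q a. q \<in> A N \<and> q \<noteq> 0 \<and> (\<forall>i<n. a i \<in> A N) \<and> q * z = (\<Sum>i<n. a i * e i)"
begin

text \<open>Elements with denominator \<open>q\<close> and numerators of size at most
  \<open>N\<close> along the generators \<open>e\<close>. The denominator is a separate parameter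
  because its size does not enter the count in \<open>card_box\<close>; it only has to be the same
  for all elements counted.\<close>

definition box :: "nat \<Rightarrow> 'a \<Rightarrow> 'a set" where
  "box N q = {z. \<exists>a. (\<forall>i<n. a i \<in> A N) \<and> q * z = (\<Sum>i<n. a i * e i)}"

lemma boxI: "(\<And>i. i < n \<Longrightarrow> a i \<in> A N) \<Longrightarrow> q * z = (\<Sum>i<n. a i * e i) \<Longrightarrow> z \<in> box N q"
  unfolding box_def by blast

lemma box_mono: "M \<le> N \<Longrightarrow> box M q \<subseteq> box N q"
  unfolding box_def using mono by blast

lemma sum_mem: "(\<And>i. i < m \<Longrightarrow> a i \<in> A N) \<Longrightarrow> (\<Sum>i<m. a i) \<in> A (m * N)"
proof (induction m)
  case 0 show ?case by (simp add: zero_mem)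
next
  case (Suc m)
  then show ?case using add[of "\<Sum>i<m. a i" "m * N" "a m" N] by (simp add: add.commute)
qed

lemma card_box:
  assumes "q \<noteq> 0"
  shows "finite (box N q)" "card (box N q) \<le> card (A N) ^ n"
proof -
  define P where "P = {..<n} \<rightarrow>\<^sub>E A N"
  have P: "finite P" "card P = card (A N) ^ n"
    unfolding P_def using finite by (auto simp: finite_PiE card_PiE)
  have sub: "box N q \<subseteq> (\<lambda>a. (\<Sum>i<n. a i * e i) / q) ` P"
  proof
    fix z assume "z \<in> box N q"
    then obtain a where a: "\<forall>i<n. a i \<in> A N" "q * z = (\<Sum>i<n. a i * e i)" by (auto simp: box_def)
    have "restrict a {..<n} \<in> P" using a(1) by (auto simp: P_def)
    moreover have "z = (\<Sum>i<n. restrict a {..<n} i * e i) / q"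
      using a(2) assms by (simp add: field_simps)
    ultimately show "z \<in> (\<lambda>a. (\<Sum>i<n. a i * e i) / q) ` P" by blast
  qed
  show "finite (box N q)" using finite_subset[OF sub] P(1) by blast
  show "card (box N q) \<le> card (A N) ^ n"
    using surj_card_le[OF P(1) sub] P(2) by simp
qed

lemma box_add:
  assumes "z \<in> box M q" "w \<in> box N q"
  shows "z + w \<in> box (M + N) q"
proof -
  obtain a b where a: "\<forall>i<n. a i \<in> A M" "q * z = (\<Sum>i<n. a i * e i)"
    and b: "\<forall>i<n. b i \<in> A N" "q * w = (\<Sum>i<n. b i * e i)" using assms by (auto simp: box_def)
  show ?thesis
    by (rule boxI[of "\<lambda>i. a i + b i"]) (use a b add in \<open>auto simp: algebra_simps sum.distrib\<close>)
qed

lemma box_scale: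
  assumes "z \<in> box N q" "r \<in> A M"
  shows "z \<in> box (M * N) (r * q)"
proof -
  obtain a where a: "\<forall>i<n. a i \<in> A N" "q * z = (\<Sum>i<n. a i * e i)" using assms by (auto simp: box_def)
  show ?thesis
    by (rule boxI[of "\<lambda>i. r * a i"]) (use a assms mult in \<open>auto simp: mult.assoc sum_distrib_left\<close>)
qed

lemma common_box:
  assumes "Finite_Set.finite I"
  shows "\<exists>N q. q \<in> A N \<and> q \<noteq> 0 \<and> (\<forall>z\<in>I. z \<in> box N q)"
  using assms
proof induction
  case empty show ?case using one_mem by (intro exI[of _ 1]) auto
next
  case (insert z I)
  then obtain N q where q: "q \<in> A N" "q \<noteq> 0" "\<forall>z\<in>I. z \<in> box N q" by blast
  obtain M r a where r: "r \<in> A M" "r \<noteq> 0" "\<forall>i<n. a i \<in> A M" "r * z = (\<Sum>i<n. a i * e i)"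
    using spanning by blast
  have "z \<in> box M r" using r by (auto simp: box_def)
  then have "z \<in> box (N * M) (q * r)" using box_scale q by blast
  moreover have "w \<in> box (N * M) (q * r)" if "w \<in> I" for w
    using box_scale[of w N q r M] q r that by (simp add: mult.commute)
  ultimately show ?case using q r mult by (intro exI[of _ "N * M"] exI[of _ "q * r"]) auto
qed

text \<open>Multiplication by \<open>x\<close> is described by a matrix with entries in
  \<open>A B\<close> and denominator \<open>q\<close>. Each new coordinate is a sum of
  \<open>n\<close> products of size at most \<open>N * B\<close>.\<close>

lemma box_times:
  assumes x: "\<And>i. i < n \<Longrightarrow> x * e i \<in> box B q" and z: "z \<in> box N r"
  shows "x * z \<in> box (n * (N * B)) (q * r)"
proof -
  obtain m where m: "\<And>i. i < n \<Longrightarrow> (\<forall>j<n. m i j \<in> A B) \<and> q * (x * e i) = (\<Sum>j<n. m i j * e j)"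
    using x unfolding box_def mem_Collect_eq by metis
  obtain a where a: "\<forall>i<n. a i \<in> A N" "r * z = (\<Sum>i<n. a i * e i)" using z by (auto simp: box_def)
  have "(\<Sum>i<n. a i * m i j) \<in> A (n * (N * B))" if "j < n" for j
    by (rule sum_mem) (use a m mult that in blast)
  moreover have "(q * r) * (x * z) = (\<Sum>j<n. (\<Sum>i<n. a i * m i j) * e j)"
  proof -
    have "(q * r) * (x * z) = q * x * (r * z)" by (simp add: algebra_simps)
    also have "\<dots> = (\<Sum>i<n. a i * (q * (x * e i)))"
      unfolding a(2) by (simp add: sum_distrib_left algebra_simps)
    also have "\<dots> = (\<Sum>i<n. \<Sum>j<n. a i * m i j * e j)"
      using m by (intro sum.cong) (auto simp: sum_distrib_left mult.assoc)
    also have "\<dots> = (\<Sum>j<n. (\<Sum>i<n. a i * m i j) * e j)"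
      by (subst sum.swap) (simp add: sum_distrib_right)
    finally show ?thesis .
  qed
  ultimately show ?thesis by (intro boxI)
qed

section \<open>Digit expansions in base \<open>x\<close>\<close>

primrec digit_sum :: "'a \<Rightarrow> 'a list \<Rightarrow> 'a" where
  "digit_sum x [] = 0"
| "digit_sum x (y # ys) = y + x * digit_sum x ys"

text \<open>One more digit multiplies the denominator by \<open>q\<close> and the numerator bound by
  at most \<open>Q + n * B\<close>: the summand \<open>Q\<close> pays for rewriting the new digit
  over the larger denominator, and \<open>n * B\<close> pays for multiplying the rest by
  \<open>x\<close>.\<close>

lemma digit_sum_box:
  assumes q: "q \<in> A Q" and x: "\<And>i. i < n \<Longrightarrow> x * e i \<in> box B q"
    and Y: "\<And>y. y \<in> Y \<Longrightarrow> y \<in> box N r" and ys: "set ys \<subseteq> Y"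
  shows "digit_sum x ys \<in> box (N * (Q + n * B) ^ length ys) (q ^ length ys * r)"
  using ys
proof (induction ys)
  case Nil
  show ?case by (rule boxI[of "\<lambda>_. 0"]) (use zero_mem in auto)
next
  case (Cons y ys)
  define h where "h = length ys"
  define L where "L = Q + n * B"
  have IH: "digit_sum x ys \<in> box (N * L ^ h) (q ^ h * r)" using Cons by (simp add: h_def L_def)
  have qh: "q ^ Suc h \<in> A (Q ^ Suc h)" for h
    using q mult by (induction h) auto
  have "y \<in> box (Q ^ Suc h * N) (q ^ Suc h * r)" using Cons Y qh by (intro box_scale) auto
  moreover have "x * digit_sum x ys \<in> box (n * (N * L ^ h * B)) (q * (q ^ h * r))"
    using x IH by (rule box_times)
  ultimately have "y + x * digit_sum x ys \<in> box (Q ^ Suc h * N + n * (N * L ^ h * B)) (q ^ Suc h * r)"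
    by (intro box_add) (auto simp: mult.assoc)
  moreover have "Q ^ Suc h * N + n * (N * L ^ h * B) \<le> N * L ^ Suc h"
  proof -
    have "Q ^ h \<le> L ^ h" by (rule power_mono) (auto simp: L_def)
    then have "Q ^ Suc h * N \<le> Q * L ^ h * N" by simp
    then show ?thesis by (simp add: L_def algebra_simps)
  qed
  ultimately have "y + x * digit_sum x ys \<in> box (N * L ^ Suc h) (q ^ Suc h * r)"
    using box_mono by blast
  then show ?case by (simp add: h_def L_def)
qed

text \<open>Digit expansions in base \<open>x\<close> with digits in \<open>Y\<close> are pairwise distinct, while the number of
  available values grows at most like \<open>L ^ (n * h)\<close> in the number \<open>h\<close> of digits, for some \<open>L\<close> that
  does not depend on \<open>Y\<close>.\<close>

lemma bounded_residues:
  fixes D :: "'a set"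
  assumes D: "0 \<in> D" "\<And>y z. y \<in> D \<Longrightarrow> z \<in> D \<Longrightarrow> y + z \<in> D" "\<And>y z. y \<in> D \<Longrightarrow> z \<in> D \<Longrightarrow> y - z \<in> D"
      "\<And>y z. y \<in> D \<Longrightarrow> z \<in> D \<Longrightarrow> y * z \<in> D" and x: "x \<in> D" "x \<noteq> 0"
  shows "\<exists>K. \<forall>Y. Finite_Set.finite Y \<and> Y \<subseteq> D \<and> (\<forall>y\<in>Y. \<forall>z\<in>Y. \<forall>d\<in>D. y - z = x * d \<longrightarrow> y = z) \<longrightarrow> card Y \<le> K"
proof -
  have "Finite_Set.finite ((\<lambda>i. x * e i) ` {..<n})" by simp
  from common_box[OF this] obtain B q where q: "q \<in> A B" "q \<noteq> 0" "\<And>i. i < n \<Longrightarrow> x * e i \<in> box B q"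
    by blast
  \<comment> \<open>\<open>Suc B\<close> in place of \<open>B\<close> makes \<open>L\<close>
    positive even if \<open>B = 0\<close>. Only \<open>x\<close> and the generators enter
    \<open>L\<close>; the set \<open>Y\<close> is not yet fixed.\<close>
  define L where "L = Suc B + n * B"
  have q': "q \<in> A (Suc B)" using q(1) mono[of B "Suc B"] by auto
  show ?thesis
  proof (intro exI[of _ "L ^ n"] allI impI, elim conjE)
    fix Y assume Y: "Finite_Set.finite Y" "Y \<subseteq> D" "\<forall>y\<in>Y. \<forall>z\<in>Y. \<forall>d\<in>D. y - z = x * d \<longrightarrow> y = z"
    from common_box[OF Y(1)] obtain N r where r: "r \<in> A N" "r \<noteq> 0" "\<And>y. y \<in> Y \<Longrightarrow> y \<in> box N r"
      by blast
    have digit_mem: "digit_sum x ys \<in> D" if "set ys \<subseteq> Y" for ys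
      using that by (induction ys) (use D x Y(2) in auto)
    have digit_inj: "ys = zs"
      if "length ys = length zs" "set ys \<subseteq> Y" "set zs \<subseteq> Y" "digit_sum x ys = digit_sum x zs" for ys zs
      using that
    proof (induction rule: list_induct2)
      case (Cons y ys z zs)
      \<comment> \<open>Equal expansions have lowest digits congruent modulo \<open>x\<close>, hence
        equal ones; then \<open>x\<close> is cancelled and the tails are compared.\<close>
      have "y - z = x * (digit_sum x zs - digit_sum x ys)" using Cons.prems(3) by (simp add: algebra_simps)
      moreover have "digit_sum x zs - digit_sum x ys \<in> D" using Cons.prems digit_mem D(3) by auto
      ultimately have "y = z" using Y(3) Cons.prems by auto
      then show ?case using Cons x(2) by auto
    qed simp
    have bound: "card Y ^ h \<le> (c * Suc N) ^ n * (L ^ n) ^ h" for h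
    proof -
      define W where "W = {ys. set ys \<subseteq> Y \<and> length ys = h}"
      \<comment> \<open>\<open>Suc N\<close> keeps the bound at least 1, the range in which
        \<open>card_le\<close> applies.\<close>
      let ?M = "Suc N * L ^ h"
      have nz: "q ^ h * r \<noteq> 0" using q r by simp
      have "card Y ^ h = card W" unfolding W_def using card_lists_length_eq[OF Y(1)] by simp
      also have "\<dots> = card (digit_sum x ` W)"
        by (rule card_image[symmetric]) (auto simp: inj_on_def W_def intro: digit_inj)
      also have "\<dots> \<le> card (box ?M (q ^ h * r))"
      proof (rule card_mono)
        show "digit_sum x ` W \<subseteq> box ?M (q ^ h * r)"
        proof safe
          fix ys assume ys: "ys \<in> W"
          have "y \<in> box (Suc N) r" if "y \<in> Y" for y using r(3)[OF that] box_mono[of N "Suc N" r] by auto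
          from digit_sum_box[OF q' q(3) this] ys show "digit_sum x ys \<in> box ?M (q ^ h * r)"
            unfolding W_def L_def by fastforce
        qed
      qed (use card_box(1)[OF nz] in simp)
      also have "\<dots> \<le> card (A ?M) ^ n" by (rule card_box(2)[OF nz])
      also have "\<dots> \<le> (c * ?M) ^ n"
      proof (rule power_mono)
        have "1 \<le> ?M" by (simp add: L_def Suc_le_eq)
        then show "card (A ?M) \<le> c * ?M" by (rule card_le)
      qed simp
      also have "\<dots> = (c * Suc N) ^ n * (L ^ n) ^ h"
        by (metis (no_types) mult.assoc mult.commute power_mult power_mult_distrib)
      finally show ?thesis .
    qed
    show "card Y \<le> L ^ n"
    proof (rule ccontr)
      assume "\<not> card Y \<le> L ^ n"
      moreover have "L ^ n > 0" by (simp add: L_def)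
      \<comment> \<open>If \<open>card Y\<close> exceeded \<open>L ^ n\<close>, the powers of this
        ratio would eventually pass the prefactor \<open>(c * Suc N) ^ n\<close>, which does not
        depend on \<open>h\<close>.\<close>
      ultimately have gt: "1 < real (card Y) / real (L ^ n)" by (simp del: of_nat_power)
      obtain h where h: "real ((c * Suc N) ^ n) < (real (card Y) / real (L ^ n)) ^ h"
        using real_arch_pow[OF gt] by blast
      have "real (card Y ^ h) \<le> real ((c * Suc N) ^ n * (L ^ n) ^ h)"
        using bound[of h] by (simp only: of_nat_le_iff)
      then have "(real (card Y) / real (L ^ n)) ^ h \<le> real ((c * Suc N) ^ n)"
        using \<open>L ^ n > 0\<close> by (simp add: power_divide divide_le_eq flip: of_nat_power of_nat_mult)
      then show False using h by simp
    qed
  qed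
qed

text \<open>Every element lies in one of countably many finite boxes. Countability is what later
  allows the nonzero elements to be enumerated when a cofinal chain of ideals is built.\<close>

lemma countable_UNIV: "countable (UNIV :: 'a set)"
proof -
  have "UNIV \<subseteq> (\<Union>N. \<Union>q\<in>A N - {0}. box N q)"
  proof
    fix z :: 'a
    obtain N q a where *: "q \<in> A N" "q \<noteq> 0" "\<forall>i<n. a i \<in> A N" "q * z = (\<Sum>i<n. a i * e i)"
      using spanning by blast
    then have "z \<in> box N q" by (auto simp: box_def)
    then show "z \<in> (\<Union>N. \<Union>q\<in>A N - {0}. box N q)" using * by blast
  qed
  moreover have "countable (\<Union>N. \<Union>q\<in>A N - {0}. box N q)"
  proof (rule countable_UN[OF countableI_type])
    show "countable (\<Union>q\<in>A N - {0}. box N q)" for N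
      using card_box(1) finite by (intro countable_UN) (auto intro: countable_finite)
  qed
  ultimately show ?thesis using countable_subset by blast
qed

end

section \<open>Fractions and coordinates over a filtered subring\<close>

lemma field_ring_simps [simp]:
  "carrier field_ring = UNIV" "\<one>\<^bsub>field_ring\<^esub> = (1::'a::field)" "\<zero>\<^bsub>field_ring\<^esub> = (0::'a)"
  "x \<oplus>\<^bsub>field_ring\<^esub> y = (x + y :: 'a)" "x \<otimes>\<^bsub>field_ring\<^esub> y = (x * y :: 'a)"
  by (simp_all add: ring_of_type_algebra_def)

lemma field_ring_uminus [simp]: "\<ominus>\<^bsub>field_ring\<^esub> x = (- x :: 'a::field)"
proof -
  interpret Ring.ring "field_ring :: 'a ring" by (rule ring_from_type_algebra)
  show ?thesis by (rule minus_equality) simp_all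
qed

lemma field_ring_inv [simp]: "x \<noteq> 0 \<Longrightarrow> inv\<^bsub>field_ring\<^esub> x = (inverse x :: 'a::field)"
proof -
  assume "x \<noteq> 0"
  interpret Ring.cring "field_ring :: 'a ring" by (rule cring_from_type_algebra)
  show ?thesis by (rule comm_inv_char) (use \<open>x \<noteq> 0\<close> in simp_all)
qed

context filtered_subring
begin

text \<open>The fractions with numerator and denominator in the union of the \<open>A N\<close> are
  closed under all field operations. Numerator and denominator share one bound \<open>N\<close>,
  which monotonicity or a common product bound provides.\<close>

lemma generate_field_fraction:
  assumes H: "H \<subseteq> (\<Union>N. A N)" and z: "z \<in> generate_field field_ring H"
  shows "\<exists>N q a. q \<in> A N \<and> q \<noteq> 0 \<and> a \<in> A N \<and> q * z = a"
  using z
proof (induction rule: generate_field.induct)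
  case one
  show ?case using one_mem by (intro exI[of _ 1]) auto
next
  case (incl h)
  then obtain N where "h \<in> A N" using H by blast
  then show ?case using one_mem mono[of 1 "Suc N"] mono[of N "Suc N"]
    by (intro exI[of _ "Suc N"] exI[of _ 1] exI[of _ h]) auto
next
  case (a_inv h)
  then obtain N q a where "q \<in> A N" "q \<noteq> 0" "a \<in> A N" "q * h = a" by blast
  then show ?case using local.uminus[of a N] by (intro exI[of _ N] exI[of _ q] exI[of _ "- a"]) auto
next
  case (m_inv h)
  then obtain N q a where "q \<in> A N" "q \<noteq> 0" "a \<in> A N" "q * h = a" by blast
  then show ?case using m_inv(2) by (intro exI[of _ N] exI[of _ a] exI[of _ q]) auto
next
  case (eng_add h1 h2)
  then obtain N q a M r b where *: "q \<in> A N" "q \<noteq> 0" "a \<in> A N" "q * h1 = a"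
    "r \<in> A M" "r \<noteq> 0" "b \<in> A M" "r * h2 = b" by metis
  have "q * r \<in> A (N * M)" "r * a \<in> A (N * M)" "q * b \<in> A (N * M)"
    using mult[of q N r M] mult[of r M a N] mult[of q N b M] * by (auto simp: mult.commute)
  then have "q * r \<in> A (N * M + N * M)" "r * a + q * b \<in> A (N * M + N * M)"
    using add mono[of "N * M" "N * M + N * M"] by auto
  moreover have "(q * r) * (h1 + h2) = r * a + q * b"
    unfolding *(4,8)[symmetric] by (simp add: algebra_simps)
  moreover have "q * r \<noteq> 0" using * by simp
  ultimately show ?case unfolding field_ring_simps by blast
next
  case (eng_mult h1 h2)
  then obtain N q a M r b where *: "q \<in> A N" "q \<noteq> 0" "a \<in> A N" "q * h1 = a"
    "r \<in> A M" "r \<noteq> 0" "b \<in> A M" "r * h2 = b" by metis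
  have "q * r \<in> A (N * M)" "a * b \<in> A (N * M)" "q * r \<noteq> 0" using * by (auto intro: mult)
  moreover have "(q * r) * (h1 * h2) = a * b" unfolding *(4,8)[symmetric] by (simp add: ac_simps)
  ultimately show ?case unfolding field_ring_simps by blast
qed

lemma common_denominator:
  fixes z :: "nat \<Rightarrow> 'a"
  assumes "\<And>i. i < n \<Longrightarrow> \<exists>N q a. q \<in> A N \<and> q \<noteq> 0 \<and> a \<in> A N \<and> q * z i = a"
  shows "\<exists>N q a. q \<in> A N \<and> q \<noteq> 0 \<and> (\<forall>i<n. a i \<in> A N \<and> q * z i = a i)"
  using assms
proof (induction n)
  case 0
  show ?case using one_mem by (intro exI[of _ 1]) auto
next
  case (Suc n)
  have "\<exists>N q a. q \<in> A N \<and> q \<noteq> 0 \<and> (\<forall>i<n. a i \<in> A N \<and> q * z i = a i)"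
    by (rule Suc.IH) (rule Suc.prems, simp)
  then obtain N q a where q: "q \<in> A N" "q \<noteq> 0" "\<forall>i<n. a i \<in> A N \<and> q * z i = a i" by blast
  obtain M r b where r: "r \<in> A M" "r \<noteq> 0" "b \<in> A M" "r * z n = b" using Suc.prems by blast
  have "(if i < n then r * a i else q * b) \<in> A (N * M) \<and>
      (q * r) * z i = (if i < n then r * a i else q * b)" if "i < Suc n" for i
  proof (cases "i < n")
    case True
    have "q * r * z i = r * (q * z i)" by (simp add: algebra_simps)
    then show ?thesis using True q mult[of r M "a i" N] r by (auto simp: mult.commute)
  next
    case False
    then have "i = n" using that by simp
    then show ?thesis using q r mult by (auto simp: mult.assoc)
  qed
  moreover have "q * r \<in> A (N * M)" "q * r \<noteq> 0" using q r mult by auto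
  ultimately show ?case
    by (intro exI[of _ "N * M"] exI[of _ "q * r"] exI[of _ "\<lambda>i. if i < n then r * a i else q * b"]) blast
qed

end

text \<open>Each \<open>line_extension\<close> in the inductive definition of dimension contributes
  its vector as the next generator. Only the spanning half of a basis is recorded.\<close>

lemma dimension_spanning:
  fixes K :: "'a::field set"
  assumes "ring.dimension field_ring n K E"
  shows "\<exists>e. \<forall>z\<in>E. \<exists>a. (\<forall>i<n. a i \<in> K) \<and> z = (\<Sum>i<n. a i * e i)"
proof -
  interpret Ring.ring "field_ring :: 'a ring" by (rule ring_from_type_algebra)
  show ?thesis
    using assms
  proof (induction rule: dimension.induct)
    case (zero_dim K) show ?case by auto
  next
    case (Suc_dim v E n K)
    then obtain e where e: "\<forall>z\<in>E. \<exists>a. (\<forall>i<n. a i \<in> K) \<and> z = (\<Sum>i<n. a i * e i)" by blast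
    show ?case
    proof (rule exI[of _ "e(n := v)"], rule ballI)
      fix z assume "z \<in> line_extension K v E"
      then obtain k w where kw: "k \<in> K" "w \<in> E" "z = k * v + w"
        unfolding line_extension_def set_add_def set_mult_def r_coset_def by auto
      then obtain a where a: "\<forall>i<n. a i \<in> K" "w = (\<Sum>i<n. a i * e i)" using e by blast
      have "(\<Sum>i<n. (a(n := k)) i * (e(n := v)) i) = (\<Sum>i<n. a i * e i)" by (rule sum.cong) auto
      then show "\<exists>a. (\<forall>i<Suc n. a i \<in> K) \<and> z = (\<Sum>i<Suc n. a i * (e(n := v)) i)"
        using a kw by (intro exI[of _ "a(n := k)"]) (auto simp: add.commute)
    qed
  qed
qed

text \<open>The coordinates of an element lie in the generated field, so they are finitely many
  fractions, and a common denominator turns them into coordinates in some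
  \<open>A N\<close>.\<close>

lemma (in filtered_subring) filtered_latticeI:
  assumes H: "H \<subseteq> (\<Union>N. A N)" 
    and fd: "ring.finite_dimension field_ring (generate_field field_ring H) UNIV"
  shows "\<exists>n e. filtered_lattice A c n e"
proof -
  interpret Ring.ring "field_ring :: 'a ring" by (rule ring_from_type_algebra)
  obtain n where "dimension n (generate_field field_ring H) UNIV"
    using fd unfolding finite_dimension_def by blast
  from dimension_spanning[OF this] obtain e where
    e: "\<And>z. \<exists>b. (\<forall>i<n. b i \<in> generate_field field_ring H) \<and> z = (\<Sum>i<n. b i * e i)" by blast
  have "filtered_lattice A c n e"
  proof
    fix z
    obtain b where b: "\<forall>i<n. b i \<in> generate_field field_ring H" "z = (\<Sum>i<n. b i * e i)" using e by blast
    have "\<exists>N q a. q \<in> A N \<and> q \<noteq> 0 \<and> (\<forall>i<n. a i \<in> A N \<and> q * b i = a i)"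
      by (rule common_denominator) (use generate_field_fraction[OF H] b(1) in blast)
    then obtain N q a where q: "q \<in> A N" "q \<noteq> 0" "\<And>i. i < n \<Longrightarrow> a i \<in> A N \<and> q * b i = a i" by blast
    have "q * z = (\<Sum>i<n. a i * e i)"
      unfolding b(2) sum_distrib_left by (rule sum.cong) (use q(3) in \<open>auto simp flip: mult.assoc\<close>)
    then show "\<exists>N q a. q \<in> A N \<and> q \<noteq> 0 \<and> (\<forall>i<n. a i \<in> A N) \<and> q * z = (\<Sum>i<n. a i * e i)"
      using q by blast
  qed
  then show ?thesis by blast
qed

section \<open>The two base rings: integers and polynomials over the prime field\<close>

lemma filtered_subring_int:
  "filtered_subring (\<lambda>N. (of_int :: int \<Rightarrow> 'a::field) ` {- int N..int N}) 3"
proof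
  fix N M :: nat and a b :: 'a
  show "Finite_Set.finite ((of_int :: int \<Rightarrow> 'a) ` {- int N..int N})" by simp
  \<comment> \<open>The constant 3 comes from 2N + 1 \<le> 3N for N \<ge> 1.\<close>
  show "card ((of_int :: int \<Rightarrow> 'a) ` {- int N..int N}) \<le> 3 * N" if "1 \<le> N"
    using card_image_le[of "{- int N..int N}" "of_int :: int \<Rightarrow> 'a"] that by simp
  show "of_int ` {- int M..int M} \<subseteq> (of_int :: int \<Rightarrow> 'a) ` {- int N..int N}" if "M \<le> N"
    using that by (intro image_mono) auto
  show "0 \<in> (of_int :: int \<Rightarrow> 'a) ` {- int N..int N}" by (intro image_eqI[of _ _ 0]) auto
  show "1 \<in> (of_int :: int \<Rightarrow> 'a) ` {- int 1..int 1}" by (intro image_eqI[of _ _ 1]) auto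
  show "- a \<in> of_int ` {- int N..int N}" if "a \<in> of_int ` {- int N..int N}"
  proof -
    from that obtain k where "a = of_int k" "k \<in> {- int N..int N}" by blast
    then show ?thesis by (intro image_eqI[of _ _ "- k"]) auto
  qed
  assume "a \<in> of_int ` {- int M..int M}" "b \<in> of_int ` {- int N..int N}"
  then obtain k l where *: "a = of_int k" "k \<in> {- int M..int M}" "b = of_int l" "l \<in> {- int N..int N}" by blast
  show "a + b \<in> of_int ` {- int (M + N)..int (M + N)}" using * by (intro image_eqI[of _ _ "k + l"]) auto
  have "\<bar>k * l\<bar> \<le> int M * int N" unfolding abs_mult by (rule mult_mono) (use * in auto)
  then have "k * l \<in> {- int (M * N)..int (M * N)}" by auto
  then show "a * b \<in> of_int ` {- int (M * N)..int (M * N)}" using * by (intro image_eqI[of _ _ "k * l"]) auto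
qed

text \<open>This is F_p[t] filtered by the norm p^deg, with elements represented by integer
  polynomials, whose degrees add exactly under multiplication. The zero polynomial has formal degree
  0 and would have norm 1; the disjunct \<open>f = 0\<close> puts it into every level, including
  level 0.\<close>

definition int_poly_values :: "'a::field \<Rightarrow> nat \<Rightarrow> 'a set" where
  "int_poly_values t N =
     {poly (map_poly of_int f) t | f. f = 0 \<or> CHAR('a) ^ Polynomial.degree f \<le> N}"

lemma int_poly_valuesI:
  "f = 0 \<or> CHAR('a) ^ Polynomial.degree f \<le> N \<Longrightarrow> poly (map_poly of_int f) t \<in> int_poly_values (t::'a::field) N"
  unfolding int_poly_values_def by blast

lemma map_poly_of_int_add: "map_poly of_int (f + g) = (map_poly of_int f + map_poly of_int g :: 'a::field poly)"
  by (simp add: poly_eq_iff coeff_map_poly)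

lemma map_poly_of_int_minus: "map_poly of_int (- f) = (- map_poly of_int f :: 'a::field poly)"
  by (simp add: poly_eq_iff coeff_map_poly)

lemma map_poly_of_int_mult: "map_poly of_int (f * g) = (map_poly of_int f * map_poly of_int g :: 'a::field poly)"
  by (simp add: poly_eq_iff coeff_map_poly coeff_mult)

lemma card_int_poly_values:
  assumes p: "CHAR('a) > 0" and N: "1 \<le> N"
  shows "Finite_Set.finite (int_poly_values (t::'a::field) N)" "card (int_poly_values t N) \<le> CHAR('a) * N"
proof -
  define p where "p = CHAR('a)"
  have p2: "1 < p"
    using p CHAR_not_1' unfolding p_def by (metis One_nat_def Suc_lessI)
  \<comment> \<open>\<open>d\<close> is the integer part of the base-p logarithm of
    \<open>N\<close>: the degrees allowed are those up to \<open>d\<close>, and the number p^(d+1)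
    of coefficient sequences is at most p * N.\<close>
  have "\<exists>d. p ^ d \<le> N \<and> N < p ^ Suc d" using ex_power_ivl1[of p N] p2 N by auto
  then obtain d where d: "p ^ d \<le> N" "N < p ^ Suc d" by blast
  define W where "W = {..<Suc d} \<rightarrow>\<^sub>E {..<p}"
  have W: "Finite_Set.finite W" "card W = p ^ Suc d" unfolding W_def by (auto simp: finite_PiE card_PiE)
  have sub: "int_poly_values t N \<subseteq> (\<lambda>b. \<Sum>i<Suc d. of_nat (b i) * t ^ i) ` W"
  proof
    fix z assume "z \<in> int_poly_values t N"
    then obtain f where f: "z = poly (map_poly of_int f) t" "f = 0 \<or> p ^ Polynomial.degree f \<le> N"
      unfolding int_poly_values_def p_def by blast
    have deg: "Polynomial.degree f \<le> d"
    proof (cases "f = 0")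
      case False
      then have "p ^ Polynomial.degree f < p ^ Suc d" using f d by simp
      then show ?thesis using p2 by (simp add: power_strict_increasing_iff del: power_Suc)
    qed simp
    \<comment> \<open>Infinitely many integer polynomials qualify, but the value depends only on the
      coefficients modulo p.\<close>
    define b where "b = (\<lambda>i\<in>{..<Suc d}. nat (poly.coeff f i mod int p))"
    have "(of_int k :: 'a) = of_nat (nat (k mod int p))" for k
    proof -
      have "(of_int k :: 'a) = of_int (k mod int p)"
      proof -
        have "(of_int k :: 'a) = of_int (int p * (k div int p) + k mod int p)" by simp
        also have "\<dots> = of_int (k mod int p)" unfolding of_int_add of_int_mult by (simp add: p_def)
        finally show ?thesis .
      qed
      also have "\<dots> = of_int (int (nat (k mod int p)))" using p2 by simp
      finally show ?thesis by simp
    qed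
    note red = this
    have "z = (\<Sum>i\<le>Polynomial.degree (map_poly of_int f :: 'a poly). poly.coeff (map_poly of_int f) i * t ^ i)"
      unfolding f(1) by (rule poly_altdef)
    also have "\<dots> = (\<Sum>i<Suc d. poly.coeff (map_poly of_int f) i * t ^ i)"
    proof (rule sum.mono_neutral_left)
      have "Polynomial.degree (map_poly of_int f :: 'a poly) \<le> d"
        using deg by (auto intro!: degree_le simp: coeff_map_poly coeff_eq_0)
      then show "{..Polynomial.degree (map_poly of_int f :: 'a poly)} \<subseteq> {..<Suc d}" by auto
    qed (auto simp: coeff_eq_0)
    also have "\<dots> = (\<Sum>i<Suc d. of_nat (b i) * t ^ i)"
      by (rule sum.cong) (auto simp: b_def coeff_map_poly red)
    finally have "z = (\<Sum>i<Suc d. of_nat (b i) * t ^ i)" .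
    moreover have "b \<in> W" using p2 by (auto simp: b_def W_def nat_less_iff)
    ultimately show "z \<in> (\<lambda>b. \<Sum>i<Suc d. of_nat (b i) * t ^ i) ` W" by blast
  qed
  show "Finite_Set.finite (int_poly_values t N)" using finite_subset[OF sub] W by blast
  have "card (int_poly_values t N) \<le> p ^ Suc d" using surj_card_le[OF W(1) sub] W(2) by simp
  also have "\<dots> \<le> p * N" using d(1) by simp
  finally show "card (int_poly_values t N) \<le> CHAR('a) * N" by (simp add: p_def)
qed

lemma filtered_subring_int_poly:
  fixes t :: "'a::field"
  assumes p: "CHAR('a) > 0"
  shows "filtered_subring (int_poly_values t) CHAR('a)"
proof
  fix N M :: nat and a b :: 'a
  have mono: "int_poly_values t M \<subseteq> int_poly_values t N" if "M \<le> N" for M N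
    using that unfolding int_poly_values_def by fastforce
  show "Finite_Set.finite (int_poly_values t N)"
    using finite_subset[OF mono[of N "Suc N"]] card_int_poly_values(1)[OF p, of "Suc N"] by simp
  show "card (int_poly_values t N) \<le> CHAR('a) * N" if "1 \<le> N"
    using card_int_poly_values(2)[OF p that] .
  show "int_poly_values t M \<subseteq> int_poly_values t N" if "M \<le> N" using mono[OF that] .
  show "0 \<in> int_poly_values t N" using int_poly_valuesI[of 0 N t] by simp
  show "1 \<in> int_poly_values t 1" using int_poly_valuesI[of 1 1 t] by simp
  show "- a \<in> int_poly_values t N" if "a \<in> int_poly_values t N"
  proof -
    from that obtain f where "a = poly (map_poly of_int f) t" "f = 0 \<or> CHAR('a) ^ Polynomial.degree f \<le> N"
      unfolding int_poly_values_def by blast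
    then show ?thesis using int_poly_valuesI[of "- f" N t] by (simp add: map_poly_of_int_minus)
  qed
  assume "a \<in> int_poly_values t M" "b \<in> int_poly_values t N"
  then obtain f g where f: "a = poly (map_poly of_int f) t" "f = 0 \<or> CHAR('a) ^ Polynomial.degree f \<le> M"
    and g: "b = poly (map_poly of_int g) t" "g = 0 \<or> CHAR('a) ^ Polynomial.degree g \<le> N"
    unfolding int_poly_values_def by blast
  have "f + g = 0 \<or> CHAR('a) ^ Polynomial.degree (f + g) \<le> M + N"
  proof (cases "f = 0 \<or> g = 0")
    case False
    have "CHAR('a) ^ Polynomial.degree (f + g) \<le> CHAR('a) ^ max (Polynomial.degree f) (Polynomial.degree g)"
      using p by (intro power_increasing degree_add_le_max) auto
    also have "\<dots> \<le> M + N" using f g False by (auto simp: max_def)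
    finally show ?thesis by simp
  qed (use f g in auto)
  from int_poly_valuesI[OF this, of t] show "a + b \<in> int_poly_values t (M + N)"
    using f g by (simp add: map_poly_of_int_add)
  have "f * g = 0 \<or> CHAR('a) ^ Polynomial.degree (f * g) \<le> M * N"
  proof (cases "f = 0 \<or> g = 0")
    case False
    then show ?thesis using f g by (auto simp: degree_mult_eq power_add intro!: mult_mono)
  qed auto
  from int_poly_valuesI[OF this, of t] show "a * b \<in> int_poly_values t (M * N)"
    using f g by (simp add: map_poly_of_int_mult)
qed

lemma global_field_filtered_lattice:
  assumes "global_field TYPE('a::field)"
  shows "\<exists>A c n e. filtered_lattice (A :: nat \<Rightarrow> 'a set) c n e"
proof (cases "number_field TYPE('a)")
  case True
  then show ?thesis
    using filtered_subring.filtered_latticeI[OF filtered_subring_int, of "{}"]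
    unfolding number_field_def by blast
next
  case False
  then obtain t :: 'a where p: "CHAR('a) > 0"
    and fd: "ring.finite_dimension field_ring (generate_field field_ring {t}) UNIV"
    using assms unfolding global_field_def global_function_field_def by blast
  \<comment> \<open>\<open>t\<close> is the value of the polynomial X, whose norm is p.\<close>
  have "t \<in> int_poly_values t CHAR('a)"
    using int_poly_valuesI[of "[:0, 1:]" "CHAR('a)" t] by (simp add: map_poly_pCons)
  then show ?thesis
    using filtered_subring.filtered_latticeI[OF filtered_subring_int_poly[OF p, of t], of "{t}"] fd by blast
qed

section \<open>The profinite completion\<close>

context cring
begin

lemma nonzero_ideals_ideal: "n \<in> nonzero_ideals R \<Longrightarrow> ideal n R"
  by (simp add: nonzero_ideals_def)

lemma nonzero_ideals_nonzero:
  assumes "n \<in> nonzero_ideals R"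
  obtains x where "x \<in> n" "x \<in> carrier R" "x \<noteq> \<zero>"
proof -
  interpret ideal n R using assms by (rule nonzero_ideals_ideal)
  have "\<zero> \<in> n" by simp
  then obtain x where "x \<in> n" "x \<noteq> \<zero>" using assms by (auto simp: nonzero_ideals_def)
  then show ?thesis using that Icarr by blast
qed

lemma Quot_carrier: "carrier (R Quot n) = {n +> a | a. a \<in> carrier R}"
  by (auto simp: FactRing_def A_RCOSETS_def')

lemma Quot_ops:
  assumes "ideal n R" "a \<in> carrier R" "b \<in> carrier R"
  shows "(n +> a) \<oplus>\<^bsub>R Quot n\<^esub> (n +> b) = n +> (a \<oplus> b)"
    and "(n +> a) \<otimes>\<^bsub>R Quot n\<^esub> (n +> b) = n +> (a \<otimes> b)"
  using ring_hom_memE(2,3)[OF ideal.rcos_ring_hom[OF assms(1)]] assms(2,3) by simp_all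

lemma Quot_one_zero:
  assumes "ideal n R"
  shows "\<one>\<^bsub>R Quot n\<^esub> = n +> \<one>" "\<zero>\<^bsub>R Quot n\<^esub> = n +> \<zero>"
proof -
  interpret ideal n R by fact
  show "\<one>\<^bsub>R Quot n\<^esub> = n +> \<one>" by (simp add: FactRing_def)
  show "\<zero>\<^bsub>R Quot n\<^esub> = n +> \<zero>" using a_rcos_zero[OF assms, of \<zero>] by (simp add: FactRing_def)
qed

lemma coset_lift:
  assumes "ideal n R" "ideal m R" "n \<subseteq> m" and a: "a \<in> carrier R"
  shows "m <+>\<^bsub>R\<^esub> (n +> a) = m +> a"
proof -
  interpret m: ideal m R by fact
  interpret n: ideal n R by fact
  show ?thesis
  proof (intro equalityI subsetI)
    fix x assume "x \<in> m <+>\<^bsub>R\<^esub> (n +> a)"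
    then obtain h k where h: "h \<in> m" "k \<in> n" "x = h \<oplus> (k \<oplus> a)"
      by (auto simp: set_add_def' a_r_coset_def')
    then have "x = (h \<oplus> k) \<oplus> a" using m.Icarr n.Icarr a by (simp add: a_assoc)
    moreover have "h \<oplus> k \<in> m" using h assms(3) by auto
    ultimately show "x \<in> m +> a" by (auto simp: a_r_coset_def')
  next
    fix x assume "x \<in> m +> a"
    then obtain h where h: "h \<in> m" "x = h \<oplus> a" by (auto simp: a_r_coset_def')
    have "\<zero> \<oplus> a \<in> n +> a" unfolding a_r_coset_def' using n.zero_closed by blast
    moreover have "x = h \<oplus> (\<zero> \<oplus> a)" using h a by simp
    ultimately show "x \<in> m <+>\<^bsub>R\<^esub> (n +> a)" unfolding set_add_def' using h by blast
  qed
qed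

text \<open>Compatibility is replaced by representability: one element of \<open>R\<close>
  represents \<open>x\<close> at level \<open>n\<close> and at every coarser level. With the
  converse \<open>completion_rep\<close>, operations on compatible families reduce to operations on
  representatives in \<open>R\<close>.\<close>

lemma completionI:
  assumes "x \<in> extensional (nonzero_ideals R)"
    and rep: "\<And>n. n \<in> nonzero_ideals R \<Longrightarrow>
      \<exists>a\<in>carrier R. \<forall>m\<in>nonzero_ideals R. n \<subseteq> m \<longrightarrow> x m = m +> a"
  shows "x \<in> carrier (completion R)"
proof -
  have "x n \<in> carrier (R Quot n)" if n: "n \<in> nonzero_ideals R" for n
    using rep[OF n] n by (auto simp: Quot_carrier)
  moreover have "m <+>\<^bsub>R\<^esub> x n = x m" if nm: "n \<in> nonzero_ideals R" "m \<in> nonzero_ideals R" "n \<subseteq> m" for n m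
  proof -
    obtain a where a: "a \<in> carrier R" "\<forall>m\<in>nonzero_ideals R. n \<subseteq> m \<longrightarrow> x m = m +> a"
      using rep[OF nm(1)] by blast
    then show ?thesis using coset_lift[of n m a] nm nonzero_ideals_ideal by simp
  qed
  ultimately show ?thesis using assms(1) by (simp add: completion_def PiE_def)
qed

lemma completion_rep:
  assumes x: "x \<in> carrier (completion R)" and n: "n \<in> nonzero_ideals R"
  obtains a where "a \<in> carrier R" "\<And>m. m \<in> nonzero_ideals R \<Longrightarrow> n \<subseteq> m \<Longrightarrow> x m = m +> a"
proof -
  have "x n \<in> carrier (R Quot n)" using x n by (auto simp: completion_def PiE_def)
  then obtain a where a: "a \<in> carrier R" "x n = n +> a" by (auto simp: Quot_carrier)
  have "x m = m +> a" if "m \<in> nonzero_ideals R" "n \<subseteq> m" for m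
  proof -
    have "x m = m <+>\<^bsub>R\<^esub> x n" using x n that by (auto simp: completion_def)
    then show ?thesis using coset_lift[of n m a] a n that nonzero_ideals_ideal by simp
  qed
  then show ?thesis using that a by blast
qed

lemma completion_extensional: "x \<in> carrier (completion R) \<Longrightarrow> x \<in> extensional (nonzero_ideals R)"
  by (auto simp: completion_def PiE_def)

lemma completion_component: "x \<in> carrier (completion R) \<Longrightarrow> n \<in> nonzero_ideals R \<Longrightarrow> x n \<in> carrier (R Quot n)"
  by (auto simp: completion_def PiE_def)

lemma completion_eqI:
  assumes "x \<in> carrier (completion R)" "y \<in> carrier (completion R)"
    and "\<And>n. n \<in> nonzero_ideals R \<Longrightarrow> x n = y n"
  shows "x = y"
  using completion_extensional[OF assms(1)] completion_extensional[OF assms(2)] assms(3)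
  by (rule extensionalityI)

lemma completion_ops [simp]:
  "\<one>\<^bsub>completion R\<^esub> = (\<lambda>n\<in>nonzero_ideals R. \<one>\<^bsub>R Quot n\<^esub>)"
  "\<zero>\<^bsub>completion R\<^esub> = (\<lambda>n\<in>nonzero_ideals R. \<zero>\<^bsub>R Quot n\<^esub>)"
  "x \<otimes>\<^bsub>completion R\<^esub> y = (\<lambda>n\<in>nonzero_ideals R. x n \<otimes>\<^bsub>R Quot n\<^esub> y n)"
  "x \<oplus>\<^bsub>completion R\<^esub> y = (\<lambda>n\<in>nonzero_ideals R. x n \<oplus>\<^bsub>R Quot n\<^esub> y n)"
  by (simp_all add: completion_def)

section \<open>Ring operations on compatible families\<close>

lemma completion_embed_closed: "a \<in> carrier R \<Longrightarrow> completion_embed R a \<in> carrier (completion R)"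
  by (rule completionI) (auto simp: completion_embed_def)

lemma completion_closed:
  assumes x: "x \<in> carrier (completion R)" and y: "y \<in> carrier (completion R)"
  shows "x \<oplus>\<^bsub>completion R\<^esub> y \<in> carrier (completion R)"
    and "x \<otimes>\<^bsub>completion R\<^esub> y \<in> carrier (completion R)"
proof -
  have "\<exists>a\<in>carrier R. \<exists>b\<in>carrier R. \<forall>m\<in>nonzero_ideals R. n \<subseteq> m \<longrightarrow> x m = m +> a \<and> y m = m +> b"
    if n: "n \<in> nonzero_ideals R" for n
  proof -
    obtain a where "a \<in> carrier R" "\<And>m. m \<in> nonzero_ideals R \<Longrightarrow> n \<subseteq> m \<Longrightarrow> x m = m +> a"
      using completion_rep[OF x n] by blast
    moreover obtain b where "b \<in> carrier R" "\<And>m. m \<in> nonzero_ideals R \<Longrightarrow> n \<subseteq> m \<Longrightarrow> y m = m +> b"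
      using completion_rep[OF y n] by blast
    ultimately show ?thesis by blast
  qed
  note reps = this
  show "x \<oplus>\<^bsub>completion R\<^esub> y \<in> carrier (completion R)"
  proof (rule completionI)
    fix n assume "n \<in> nonzero_ideals R"
    from reps[OF this] obtain a b where *: "a \<in> carrier R" "b \<in> carrier R"
      "\<forall>m\<in>nonzero_ideals R. n \<subseteq> m \<longrightarrow> x m = m +> a \<and> y m = m +> b" by blast
    show "\<exists>a\<in>carrier R. \<forall>m\<in>nonzero_ideals R. n \<subseteq> m \<longrightarrow> (x \<oplus>\<^bsub>completion R\<^esub> y) m = m +> a"
      using * Quot_ops nonzero_ideals_ideal by (intro bexI[of _ "a \<oplus> b"]) auto
  qed simp
  show "x \<otimes>\<^bsub>completion R\<^esub> y \<in> carrier (completion R)"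
  proof (rule completionI)
    fix n assume "n \<in> nonzero_ideals R"
    from reps[OF this] obtain a b where *: "a \<in> carrier R" "b \<in> carrier R"
      "\<forall>m\<in>nonzero_ideals R. n \<subseteq> m \<longrightarrow> x m = m +> a \<and> y m = m +> b" by blast
    show "\<exists>a\<in>carrier R. \<forall>m\<in>nonzero_ideals R. n \<subseteq> m \<longrightarrow> (x \<otimes>\<^bsub>completion R\<^esub> y) m = m +> a"
      using * Quot_ops nonzero_ideals_ideal by (intro bexI[of _ "a \<otimes> b"]) auto
  qed simp
qed

lemma completion_neg:
  assumes x: "x \<in> carrier (completion R)"
  shows "\<exists>y\<in>carrier (completion R). y \<oplus>\<^bsub>completion R\<^esub> x = \<zero>\<^bsub>completion R\<^esub>"
proof -
  define y where "y = (\<lambda>n\<in>nonzero_ideals R. \<ominus>\<^bsub>R Quot n\<^esub> x n)"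
  have neg: "\<ominus>\<^bsub>R Quot n\<^esub> (n +> a) = n +> (\<ominus> a)" if n: "n \<in> nonzero_ideals R" and a: "a \<in> carrier R" for n a
  proof -
    interpret I: ideal n R using n by (rule nonzero_ideals_ideal)
    interpret Q: Ring.ring "R Quot n" by (rule I.quotient_is_ring)
    show ?thesis
    proof (rule Q.minus_equality)
      show "(n +> \<ominus> a) \<oplus>\<^bsub>R Quot n\<^esub> (n +> a) = \<zero>\<^bsub>R Quot n\<^esub>"
        using a Quot_ops(1)[OF I.is_ideal, of "\<ominus> a" a] Quot_one_zero(2)[OF I.is_ideal] by (simp add: l_neg)
    qed (use a in \<open>auto simp: Quot_carrier\<close>)
  qed
  have "y \<in> carrier (completion R)"
  proof (rule completionI)
    fix n assume n: "n \<in> nonzero_ideals R"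
    obtain a where "a \<in> carrier R" "\<And>m. m \<in> nonzero_ideals R \<Longrightarrow> n \<subseteq> m \<Longrightarrow> x m = m +> a"
      using completion_rep[OF x n] by blast
    then show "\<exists>a\<in>carrier R. \<forall>m\<in>nonzero_ideals R. n \<subseteq> m \<longrightarrow> y m = m +> a"
      using neg by (intro bexI[of _ "\<ominus> a"]) (auto simp: y_def)
  qed (simp add: y_def)
  moreover have "y \<oplus>\<^bsub>completion R\<^esub> x = \<zero>\<^bsub>completion R\<^esub>"
    unfolding completion_ops
  proof (rule restrict_ext)
    fix n assume n: "n \<in> nonzero_ideals R"
    interpret I: ideal n R using n by (rule nonzero_ideals_ideal)
    interpret Q: Ring.ring "R Quot n" by (rule I.quotient_is_ring)
    show "y n \<oplus>\<^bsub>R Quot n\<^esub> x n = \<zero>\<^bsub>R Quot n\<^esub>"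
      using completion_component[OF x n] n by (simp add: y_def Q.l_neg)
  qed
  ultimately show ?thesis by blast
qed

lemma completion_cring: "cring (completion R)"
proof -
  have Q: "cring (R Quot n)" if "n \<in> nonzero_ideals R" for n
    using ideal.quotient_is_cring[OF nonzero_ideals_ideal[OF that]] is_cring by simp
  have one: "\<one>\<^bsub>completion R\<^esub> \<in> carrier (completion R)"
    by (rule completionI) (auto simp: Quot_one_zero nonzero_ideals_ideal intro!: bexI[of _ \<one>])
  have zero: "\<zero>\<^bsub>completion R\<^esub> \<in> carrier (completion R)"
    by (rule completionI) (auto simp: Quot_one_zero nonzero_ideals_ideal intro!: bexI[of _ \<zero>])
  have ag: "abelian_group (completion R)"
  proof (rule abelian_groupI)
    fix x y z assume xyz: "x \<in> carrier (completion R)" "y \<in> carrier (completion R)" "z \<in> carrier (completion R)"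
    show "x \<oplus>\<^bsub>completion R\<^esub> y \<oplus>\<^bsub>completion R\<^esub> z = x \<oplus>\<^bsub>completion R\<^esub> (y \<oplus>\<^bsub>completion R\<^esub> z)"
      unfolding completion_ops
      by (rule restrict_ext) (simp add: completion_component xyz cring.cring_simprules(7)[OF Q])
  next
    fix x y assume xyz: "x \<in> carrier (completion R)" "y \<in> carrier (completion R)"
    show "x \<oplus>\<^bsub>completion R\<^esub> y = y \<oplus>\<^bsub>completion R\<^esub> x"
      unfolding completion_ops
      by (rule restrict_ext) (rule cring.cring_simprules(10)[OF Q]; simp add: completion_component xyz)
  next
    fix x assume x: "x \<in> carrier (completion R)"
    show "\<zero>\<^bsub>completion R\<^esub> \<oplus>\<^bsub>completion R\<^esub> x = x"
      by (rule completion_eqI[OF completion_closed(1)[OF zero x] x])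
        (use x in \<open>simp add: cring.cring_simprules(8)[OF Q] completion_component\<close>)
    show "\<exists>y\<in>carrier (completion R). y \<oplus>\<^bsub>completion R\<^esub> x = \<zero>\<^bsub>completion R\<^esub>"
      using x by (rule completion_neg)
  qed (use zero completion_closed in auto)
  have cm: "comm_monoid (completion R)"
  proof (rule comm_monoidI)
    fix x y z assume xyz: "x \<in> carrier (completion R)" "y \<in> carrier (completion R)" "z \<in> carrier (completion R)"
    show "x \<otimes>\<^bsub>completion R\<^esub> y \<otimes>\<^bsub>completion R\<^esub> z = x \<otimes>\<^bsub>completion R\<^esub> (y \<otimes>\<^bsub>completion R\<^esub> z)"
      unfolding completion_ops
      by (rule restrict_ext) (simp add: completion_component xyz cring.cring_simprules(11)[OF Q])
  next
    fix x y assume xyz: "x \<in> carrier (completion R)" "y \<in> carrier (completion R)"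
    show "x \<otimes>\<^bsub>completion R\<^esub> y = y \<otimes>\<^bsub>completion R\<^esub> x"
      unfolding completion_ops
      by (rule restrict_ext) (rule cring.cring_simprules(14)[OF Q]; simp add: completion_component xyz)
  next
    fix x assume x: "x \<in> carrier (completion R)"
    show "\<one>\<^bsub>completion R\<^esub> \<otimes>\<^bsub>completion R\<^esub> x = x"
      by (rule completion_eqI[OF completion_closed(2)[OF one x] x])
        (use x in \<open>simp add: cring.cring_simprules(12)[OF Q] completion_component\<close>)
  qed (use one completion_closed in auto)
  show ?thesis
  proof (rule cringI[OF ag cm])
    fix x y z assume xyz: "x \<in> carrier (completion R)" "y \<in> carrier (completion R)" "z \<in> carrier (completion R)"
    show "(x \<oplus>\<^bsub>completion R\<^esub> y) \<otimes>\<^bsub>completion R\<^esub> z = x \<otimes>\<^bsub>completion R\<^esub> z \<oplus>\<^bsub>completion R\<^esub> y \<otimes>\<^bsub>completion R\<^esub> z"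
      unfolding completion_ops
      by (rule restrict_ext) (simp add: completion_component xyz cring.cring_simprules(13)[OF Q])
  qed
qed

end

section \<open>Haar measure on the completion\<close>

text \<open>Finite quotients make the completion compact and turn the cardinalities in
  \<open>tilde_measure\<close> into genuine indices; countability of the carrier makes a sequence of
  levels sufficient.\<close>

locale residually_finite_domain = domain +
  assumes finite_Quot: "n \<in> nonzero_ideals R \<Longrightarrow> finite (carrier (R Quot n))"
    and countable_carrier: "countable (carrier R)"
begin

lemma PIdl_nonzero: "a \<in> carrier R \<Longrightarrow> a \<noteq> \<zero> \<Longrightarrow> PIdl a \<in> nonzero_ideals R"
  using cgenideal_ideal[of a] cgenideal_self[of a] by (auto simp: nonzero_ideals_def)

text \<open>Enumerate the nonzero elements as \<open>g\<close> and let \<open>N k\<close> be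
  generated by the product of \<open>g 0\<close> to \<open>g k\<close>, nonzero in a domain. A
  nonzero ideal contains some \<open>g k\<close>, hence that product and all of
  \<open>N k\<close>.\<close>

lemma cofinal_chain:
  "\<exists>N :: nat \<Rightarrow> 'a set. (\<forall>k. N k \<in> nonzero_ideals R) \<and> (\<forall>j k. j \<le> k \<longrightarrow> N k \<subseteq> N j) \<and>
    (\<forall>n\<in>nonzero_ideals R. \<exists>k. N k \<subseteq> n)"
proof -
  define g where "g = from_nat_into (carrier R - {\<zero>})"
  have ne: "carrier R - {\<zero>} \<noteq> {}" using one_not_zero by blast
  have range_g: "range g = carrier R - {\<zero>}"
    unfolding g_def by (rule range_from_nat_into[OF ne]) (simp add: countable_carrier)
  have g: "g k \<in> carrier R" "g k \<noteq> \<zero>" for k using range_g by blast+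
  define P where "P = rec_nat (g 0) (\<lambda>k p. p \<otimes> g (Suc k))"
  have P_Suc: "P (Suc k) = P k \<otimes> g (Suc k)" and P_0: "P 0 = g 0" for k by (simp_all add: P_def)
  have P: "P k \<in> carrier R \<and> P k \<noteq> \<zero>" for k
    by (induction k) (auto simp: P_0 P_Suc g integral_iff)
  define N where "N k = PIdl (P k)" for k
  show ?thesis
  proof (intro exI[of _ N] conjI allI impI ballI)
    show "N k \<in> nonzero_ideals R" for k unfolding N_def using P PIdl_nonzero by blast
    have "N (Suc k) \<subseteq> N k" for k
      unfolding N_def
    proof (rule cgenideal_minimal)
      show "ideal (PIdl (P k)) R" using P cgenideal_ideal by blast
      show "P (Suc k) \<in> PIdl (P k)" unfolding P_Suc cgenideal_def using P[of k] g m_comm by blast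
    qed
    then show "N k \<subseteq> N j" if "j \<le> k" for j k using that by (rule lift_Suc_antimono_le)
    fix n assume n: "n \<in> nonzero_ideals R"
    then obtain x where x: "x \<in> n" "x \<in> carrier R" "x \<noteq> \<zero>" by (rule nonzero_ideals_nonzero)
    then obtain k where k: "x = g k" using range_g by blast
    interpret n: ideal n R using n by (rule nonzero_ideals_ideal)
    have "P k \<in> n"
    proof (cases k)
      case (Suc j)
      then show ?thesis using x k P n.I_l_closed by (auto simp: P_Suc)
    qed (use x k in \<open>simp add: P_0\<close>)
    then show "\<exists>k. N k \<subseteq> n" unfolding N_def using cgenideal_minimal n.is_ideal by blast
  qed
qed

section \<open>Compactness and a countable system of neighbourhoods\<close>

lemma topspace_completion [simp]: "topspace (completion_topology R) = carrier (completion R)"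
  by (auto simp: completion_topology_def completion_def PiE_def)

lemma openin_coordinate:
  assumes "n \<in> nonzero_ideals R"
  shows "openin (completion_topology R) {y \<in> carrier (completion R). y n = q}"
proof (cases "q \<in> carrier (R Quot n)")
  case True
  let ?P = "product_topology (\<lambda>n. discrete_topology (carrier (R Quot n))) (nonzero_ideals R)"
  have "openin ?P {y \<in> topspace ?P. y n \<in> {q}}"
    by (rule openin_continuous_map_preimage[OF continuous_map_product_projection[OF assms]]) (use True in simp)
  then have "openin (completion_topology R) ({y \<in> topspace ?P. y n \<in> {q}} \<inter> carrier (completion R))"
    unfolding completion_topology_def by (rule openin_subtopology_Int)
  moreover have "{y \<in> topspace ?P. y n \<in> {q}} \<inter> carrier (completion R) = {y \<in> carrier (completion R). y n = q}"
    by (auto simp: completion_def PiE_def)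
  ultimately show ?thesis by simp
next
  case False
  then have "{y \<in> carrier (completion R). y n = q} = {}" using completion_component assms by blast
  then show ?thesis by (simp only: openin_empty)
qed

text \<open>By Tychonoff the product of the finite quotients is compact. Failure of compatibility at
  a pair of ideals is visible on two coordinates, so it is an open condition and the completion is
  closed.\<close>

lemma compact_completion: "compact_space (completion_topology R)"
proof -
  let ?P = "product_topology (\<lambda>n. discrete_topology (carrier (R Quot n))) (nonzero_ideals R)"
  have comp: "compact_space ?P"
    by (simp add: compact_space_product_topology compact_space_discrete_topology finite_Quot)
  have proj: "openin ?P {y \<in> topspace ?P. y n = q}" if n: "n \<in> nonzero_ideals R" "q \<in> carrier (R Quot n)" for n q
  proof -
    have "openin ?P {y \<in> topspace ?P. y n \<in> {q}}"
      by (rule openin_continuous_map_preimage[OF continuous_map_product_projection[OF n(1)]]) (use n in simp)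
    then show ?thesis by simp
  qed
  have "closedin ?P (carrier (completion R))"
    unfolding closedin_def
  proof
    show "carrier (completion R) \<subseteq> topspace ?P" by (auto simp: completion_def PiE_def)
    show "openin ?P (topspace ?P - carrier (completion R))"
    proof (subst openin_subopen, intro ballI)
      fix x assume x: "x \<in> topspace ?P - carrier (completion R)"
      then obtain n m where nm: "n \<in> nonzero_ideals R" "m \<in> nonzero_ideals R" "n \<subseteq> m" "m <+>\<^bsub>R\<^esub> x n \<noteq> x m"
        unfolding completion_def by auto
      have xc: "x n \<in> carrier (R Quot n)" "x m \<in> carrier (R Quot m)" using x nm by auto
      show "\<exists>T. openin ?P T \<and> x \<in> T \<and> T \<subseteq> topspace ?P - carrier (completion R)"
      proof (intro exI[of _ "{y \<in> topspace ?P. y n = x n} \<inter> {y \<in> topspace ?P. y m = x m}"] conjI)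
        show "openin ?P ({y \<in> topspace ?P. y n = x n} \<inter> {y \<in> topspace ?P. y m = x m})"
          using proj nm xc by (intro openin_Int) auto
        show "x \<in> {y \<in> topspace ?P. y n = x n} \<inter> {y \<in> topspace ?P. y m = x m}" using x by simp
        have "m <+>\<^bsub>R\<^esub> y n = y m" if "y \<in> carrier (completion R)" for y
          using that nm by (auto simp: completion_def)
        then show "{y \<in> topspace ?P. y n = x n} \<inter> {y \<in> topspace ?P. y m = x m} \<subseteq> topspace ?P - carrier (completion R)"
          using nm(4) by fastforce
      qed
    qed
  qed
  then have "compactin ?P (carrier (completion R))" using comp closedin_compact_space by blast
  then show ?thesis unfolding completion_topology_def by (rule compact_space_subtopology)
qed

lemma completion_agree:
  assumes "x \<in> carrier (completion R)" "y \<in> carrier (completion R)"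
    and "n \<in> nonzero_ideals R" "m \<in> nonzero_ideals R" "n \<subseteq> m" "x n = y n"
  shows "x m = y m"
proof -
  have "m <+>\<^bsub>R\<^esub> x n = x m" "m <+>\<^bsub>R\<^esub> y n = y m" using assms by (auto simp: completion_def)
  then show ?thesis using assms(6) by simp
qed

text \<open>A basic open set restricts finitely many coordinates, and all of them are determined by
  the coordinate at a single \<open>N k\<close> contained in each of these ideals.\<close>

lemma completion_base:
  fixes N :: "nat \<Rightarrow> 'a set"
  assumes N: "\<And>k. N k \<in> nonzero_ideals R" "\<And>j k. j \<le> k \<Longrightarrow> N k \<subseteq> N j"
      "\<And>n. n \<in> nonzero_ideals R \<Longrightarrow> \<exists>k. N k \<subseteq> n"
    and V: "openin (completion_topology R) V" "x \<in> V"
  shows "\<exists>k. {y \<in> carrier (completion R). y (N k) = x (N k)} \<subseteq> V"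
proof -
  let ?P = "product_topology (\<lambda>n. discrete_topology (carrier (R Quot n))) (nonzero_ideals R)"
  obtain W where W: "openin ?P W" "V = W \<inter> carrier (completion R)"
    using V(1) unfolding completion_topology_def openin_subtopology by blast
  have x: "x \<in> carrier (completion R)" using V W by blast
  obtain U where U: "finite {n \<in> nonzero_ideals R. U n \<noteq> carrier (R Quot n)}"
    "x \<in> PiE (nonzero_ideals R) U" "PiE (nonzero_ideals R) U \<subseteq> W"
    using W V(2) unfolding openin_product_topology_alt by auto
  define F where "F = {n \<in> nonzero_ideals R. U n \<noteq> carrier (R Quot n)}"
  have "\<forall>n\<in>F. \<exists>k. N k \<subseteq> n" using N(3) by (auto simp: F_def)
  then obtain h where h: "\<forall>n\<in>F. N (h n) \<subseteq> n" by metis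
  \<comment> \<open>The inserted 0 covers the case that no coordinate is restricted.\<close>
  define k where "k = Max (insert 0 (h ` F))"
  have k: "N k \<subseteq> n" if "n \<in> F" for n
  proof -
    have "h n \<le> k" unfolding k_def using U(1) that by (intro Max_ge) (auto simp: F_def)
    then show ?thesis using N(2) h that by blast
  qed
  have "y \<in> V" if y: "y \<in> carrier (completion R)" "y (N k) = x (N k)" for y
  proof -
    have "y n \<in> U n" if n: "n \<in> nonzero_ideals R" for n
    proof (cases "n \<in> F")
      case True
      then have "y n = x n" using completion_agree[OF y(1) x N(1) n k[OF True] y(2)] by simp
      then show ?thesis using U(2) n by auto
    next
      case False
      then have "U n = carrier (R Quot n)" using n by (simp add: F_def)
      then show ?thesis using completion_component[OF y(1) n] by simp
    qed
    then have "y \<in> PiE (nonzero_ideals R) U" using completion_extensional[OF y(1)] by (auto simp: PiE_def)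
    then show ?thesis using U(3) W(2) y(1) by blast
  qed
  then show ?thesis by blast
qed

section \<open>Translations of powers of the completion\<close>

abbreviation cpow :: "nat \<Rightarrow> (nat \<Rightarrow> 'a set \<Rightarrow> 'a set) set" where
  "cpow m \<equiv> {..<m} \<rightarrow>\<^sub>E carrier (completion R)"

text \<open>The body copies the map inside \<open>normalized_Haar\<close>, so invariance under
  \<open>translate\<close> is the required property after unfolding.\<close>

definition translate :: "nat \<Rightarrow> (nat \<Rightarrow> 'a set \<Rightarrow> 'a set) \<Rightarrow> (nat \<Rightarrow> 'a set \<Rightarrow> 'a set) \<Rightarrow> nat \<Rightarrow> 'a set \<Rightarrow> 'a set" where
  "translate m a x = (\<lambda>i\<in>{..<m}. a i \<oplus>\<^bsub>completion R\<^esub> x i)"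

lemma cpow_proj_eq_iff:
  "cpow_proj m n x = cpow_proj m n y \<longleftrightarrow> (\<forall>i<m. x i n = y i n)"
  by (auto simp: cpow_proj_def fun_eq_iff restrict_def)

lemma fibre_PiE:
  "{y \<in> cpow m. cpow_proj m n y = cpow_proj m n x} = (\<Pi>\<^sub>E i\<in>{..<m}. {y \<in> carrier (completion R). y n = x i n})"
  unfolding cpow_proj_eq_iff by (auto simp: PiE_iff extensional_def)

lemma topspace_cpow [simp]: "topspace (cpow_topology R m) = cpow m"
  by simp

lemma openin_fibre_cpow:
  assumes "n \<in> nonzero_ideals R"
  shows "openin (cpow_topology R m) {y \<in> cpow m. cpow_proj m n y = cpow_proj m n x}"
  unfolding fibre_PiE by (subst openin_PiE) (use openin_coordinate[OF assms] in auto)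

lemma translate_closed: "a \<in> cpow m \<Longrightarrow> x \<in> cpow m \<Longrightarrow> translate m a x \<in> cpow m"
  unfolding translate_def by (intro restrict_PiE_iff[THEN iffD2] ballI completion_closed(1)) auto

lemma translate_component:
  "i < m \<Longrightarrow> n \<in> nonzero_ideals R \<Longrightarrow> translate m a x i n = a i n \<oplus>\<^bsub>R Quot n\<^esub> x i n"
  by (simp add: translate_def)

lemma translate_transitive:
  assumes x: "x \<in> cpow m" and y: "y \<in> cpow m"
  shows "\<exists>a\<in>cpow m. translate m a x = y"
proof -
  interpret C: cring "completion R" by (rule completion_cring)
  define a where "a = (\<lambda>i\<in>{..<m}. y i \<ominus>\<^bsub>completion R\<^esub> x i)"
  have a: "a \<in> cpow m"
    unfolding a_def by (intro restrict_PiE_iff[THEN iffD2] ballI C.minus_closed) (use x y in auto)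
  have "translate m a x i = y i" for i
  proof (cases "i < m")
    case True
    have "x i \<in> carrier (completion R)" "y i \<in> carrier (completion R)" using x y True by auto
    then have "y i \<ominus>\<^bsub>completion R\<^esub> x i \<oplus>\<^bsub>completion R\<^esub> x i = y i"
      using C.minus_eq C.a_assoc C.l_neg C.r_zero C.a_inv_closed by metis
    then show ?thesis using True by (simp add: translate_def a_def del: completion_ops)
  next
    case False
    then show ?thesis using y by (auto simp: translate_def PiE_iff extensional_def)
  qed
  then show ?thesis using a by blast
qed

lemma translate_surj:
  assumes a: "a \<in> cpow m"
  shows "translate m a ` cpow m = cpow m"
proof
  show "translate m a ` cpow m \<subseteq> cpow m" using translate_closed[OF a] by blast
  show "cpow m \<subseteq> translate m a ` cpow m"
  proof
    fix y assume y: "y \<in> cpow m"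
    obtain b where b: "b \<in> cpow m" "translate m b a = y" using translate_transitive[OF a y] by blast
    interpret C: cring "completion R" by (rule completion_cring)
    have "translate m b a = translate m a b"
      unfolding translate_def by (rule restrict_ext) (use a b C.a_comm in auto)
    then show "y \<in> translate m a ` cpow m" using b by blast
  qed
qed

lemma translate_equivariant:
  assumes a: "a \<in> cpow m" and x: "x \<in> cpow m" and y: "y \<in> cpow m" and n: "n \<in> nonzero_ideals R"
  shows "cpow_proj m n (translate m a x) = cpow_proj m n (translate m a y) \<longleftrightarrow> cpow_proj m n x = cpow_proj m n y"
proof -
  interpret I: ideal n R using n by (rule nonzero_ideals_ideal)
  interpret Q: Ring.ring "R Quot n" by (rule I.quotient_is_ring)
  have "a i n \<oplus>\<^bsub>R Quot n\<^esub> x i n = a i n \<oplus>\<^bsub>R Quot n\<^esub> y i n \<longleftrightarrow> x i n = y i n" if "i < m" for i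
  proof -
    have "a i n \<in> carrier (R Quot n)" "x i n \<in> carrier (R Quot n)" "y i n \<in> carrier (R Quot n)"
      using that a x y by (auto simp: PiE_iff intro!: completion_component[OF _ n])
    then show ?thesis by (metis Q.r_neg1)
  qed
  then show ?thesis unfolding cpow_proj_eq_iff using n by (auto simp: translate_component)
qed

lemma translate_inj:
  assumes a: "a \<in> cpow m"
  shows "inj_on (translate m a) (cpow m)"
proof (rule inj_onI)
  fix x y assume x: "x \<in> cpow m" and y: "y \<in> cpow m" and e: "translate m a x = translate m a y"
  have "x i = y i" if i: "i \<in> {..<m}" for i
  proof (rule completion_eqI)
    show "x i \<in> carrier (completion R)" "y i \<in> carrier (completion R)" using x y i by auto
    fix n assume n: "n \<in> nonzero_ideals R"
    show "x i n = y i n" using translate_equivariant[OF a x y n] e i by (auto simp: cpow_proj_eq_iff)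
  qed
  then show "x = y" using x y by (intro PiE_ext[of x _ _ y]) auto
qed

lemma cpow_nonempty: "cpow m \<noteq> {}"
proof -
  have "(\<lambda>i\<in>{..<m}. completion_embed R \<one>) \<in> cpow m" using completion_embed_closed by auto
  then show ?thesis by blast
qed

text \<open>An instance of \<open>profinite_system\<close>: level \<open>k\<close> is reduction of
  all coordinates modulo \<open>N k\<close>, and the maps are the translations, which act
  transitively and respect congruences.\<close>

lemma normalized_Haar_exists: "\<exists>\<mu>. normalized_Haar R m \<mu>"
proof -
  obtain N :: "nat \<Rightarrow> 'a set" where chain: "\<forall>k. N k \<in> nonzero_ideals R" "\<forall>j k. j \<le> k \<longrightarrow> N k \<subseteq> N j"
      "\<forall>n\<in>nonzero_ideals R. \<exists>k. N k \<subseteq> n" using cofinal_chain by blast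
  have N: "\<And>k. N k \<in> nonzero_ideals R" "\<And>j k. j \<le> k \<Longrightarrow> N k \<subseteq> N j"
      "\<And>n. n \<in> nonzero_ideals R \<Longrightarrow> \<exists>k. N k \<subseteq> n" using chain by auto
  interpret profinite_system "cpow_topology R m" "cpow m" "\<lambda>k. cpow_proj m (N k)" "translate m ` cpow m"
  proof
    show "topspace (cpow_topology R m) = cpow m" by simp
    show "compact_space (cpow_topology R m)"
      using compact_completion by (simp add: compact_space_product_topology)
    show "cpow m \<noteq> {}" by (rule cpow_nonempty)
    show "openin (cpow_topology R m) {y \<in> cpow m. cpow_proj m (N k) y = cpow_proj m (N k) x}" for k x
      by (rule openin_fibre_cpow[OF N(1)])
    show "cpow_proj m (N k) x = cpow_proj m (N k) y"
      if "x \<in> cpow m" "y \<in> cpow m" "cpow_proj m (N (Suc k)) x = cpow_proj m (N (Suc k)) y" for k x y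
      unfolding cpow_proj_eq_iff
    proof (intro allI impI)
      fix i assume i: "i < m"
      show "x i (N k) = y i (N k)"
        by (rule completion_agree[OF _ _ N(1) N(1) N(2)[of k "Suc k"]]) (use that i in \<open>auto simp: cpow_proj_eq_iff\<close>)
    qed
    show "\<exists>k. {y \<in> cpow m. cpow_proj m (N k) y = cpow_proj m (N k) x} \<subseteq> U"
      if U: "openin (cpow_topology R m) U" "x \<in> U" for U x
    proof -
      obtain V where V: "\<And>i. i < m \<Longrightarrow> openin (completion_topology R) (V i)"
        "x \<in> PiE {..<m} V" "PiE {..<m} V \<subseteq> U"
        using U unfolding openin_product_topology_alt by (metis lessThan_iff)
      define h where "h i = (SOME k. {y \<in> carrier (completion R). y (N k) = x i (N k)} \<subseteq> V i)" for i
      have h: "{y \<in> carrier (completion R). y (N (h i)) = x i (N (h i))} \<subseteq> V i" if i: "i < m" for i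
      proof -
        have "\<exists>k. {y \<in> carrier (completion R). y (N k) = x i (N k)} \<subseteq> V i"
          by (rule completion_base[OF N V(1)[OF i]]) (use V(2) i in auto)
        then show ?thesis unfolding h_def by (rule someI_ex)
      qed
      define k where "k = Max (insert 0 (h ` {..<m}))"
      have k: "h i \<le> k" if "i < m" for i unfolding k_def using that by (intro Max_ge) auto
      have x: "x \<in> cpow m" using U openin_subset by fastforce
      have "y \<in> U" if y: "y \<in> cpow m" "cpow_proj m (N k) y = cpow_proj m (N k) x" for y
      proof -
        have "y i \<in> V i" if i: "i < m" for i
        proof -
          have yi: "y i \<in> carrier (completion R)" "x i \<in> carrier (completion R)" using x y i by auto
          have "y i (N k) = x i (N k)" using y(2) i by (auto simp: cpow_proj_eq_iff)
          then have "y i (N (h i)) = x i (N (h i))"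
            using completion_agree[OF yi N(1) N(1) N(2)[OF k[OF i]]] by simp
          then show ?thesis using h[OF i] yi by blast
        qed
        then have "y \<in> PiE {..<m} V" using y(1) by (auto simp: PiE_iff)
        then show ?thesis using V(3) by blast
      qed
      then show ?thesis by blast
    qed
    show "g ` cpow m = cpow m" if g: "g \<in> translate m ` cpow m" for g
    proof -
      from g obtain a where a: "g = translate m a" "a \<in> cpow m" by (rule imageE)
      show ?thesis unfolding a(1) by (rule translate_surj[OF a(2)])
    qed
    show "cpow_proj m (N k) (g x) = cpow_proj m (N k) (g y) \<longleftrightarrow> cpow_proj m (N k) x = cpow_proj m (N k) y"
      if g: "g \<in> translate m ` cpow m" and xy: "x \<in> cpow m" "y \<in> cpow m" for g k x y
    proof -
      from g obtain a where a: "g = translate m a" "a \<in> cpow m" by (rule imageE)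
      show ?thesis unfolding a(1) by (rule translate_equivariant[OF a(2) xy N(1)])
    qed
    show "\<exists>g\<in>translate m ` cpow m. g x = y" if xy: "x \<in> cpow m" "y \<in> cpow m" for x y
      unfolding bex_simps(7) by (rule translate_transitive[OF xy])
  qed
  obtain \<mu> where \<mu>: "sets \<mu> = sets (borel_of_topology (cpow_topology R m))" "emeasure \<mu> (space \<mu>) = 1"
    "\<And>g A. g \<in> translate m ` cpow m \<Longrightarrow> inj_on g (cpow m) \<Longrightarrow> A \<in> sets \<mu> \<Longrightarrow> emeasure \<mu> (g ` A) = emeasure \<mu> A"
    using invariant_measure_exists by blast
  have "emeasure \<mu> ((\<lambda>x. \<lambda>i\<in>{..<m}. a i \<oplus>\<^bsub>completion R\<^esub> x i) ` A) = emeasure \<mu> A"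
    if "a \<in> cpow m" "A \<in> sets \<mu>" for a A
    using \<mu>(3)[of "translate m a" A] translate_inj that unfolding translate_def by blast
  then have "normalized_Haar R m \<mu>" unfolding normalized_Haar_def using \<mu>(1,2) by blast
  then show ?thesis by blast
qed

lemma Haar:
  "sets (Haar_measure R m) = sets (borel_of_topology (cpow_topology R m))"
  "emeasure (Haar_measure R m) (space (Haar_measure R m)) = 1"
  "a \<in> cpow m \<Longrightarrow> A \<in> sets (Haar_measure R m) \<Longrightarrow>
     emeasure (Haar_measure R m) (translate m a ` A) = emeasure (Haar_measure R m) A"
proof -
  have *: "normalized_Haar R m (Haar_measure R m)"
    unfolding Haar_measure_def using normalized_Haar_exists by (rule someI_ex)
  show "sets (Haar_measure R m) = sets (borel_of_topology (cpow_topology R m))"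
    "emeasure (Haar_measure R m) (space (Haar_measure R m)) = 1"
    using * by (simp_all add: normalized_Haar_def)
  show "emeasure (Haar_measure R m) (translate m a ` A) = emeasure (Haar_measure R m) A"
    if "a \<in> cpow m" "A \<in> sets (Haar_measure R m)"
    using * that unfolding normalized_Haar_def translate_def by blast
qed

section \<open>Haar measure of congruence classes\<close>

lemma sets_borel_of_topology: "sets (borel_of_topology T) = sigma_sets (topspace T) {U. openin T U}"
  unfolding borel_of_topology_def using openin_subset by (subst sets_measure_of) auto

lemma openin_Haar: "openin (cpow_topology R m) U \<Longrightarrow> U \<in> sets (Haar_measure R m)"
  unfolding Haar(1) sets_borel_of_topology by (rule sigma_sets.Basic) simp

lemma space_Haar: "space (Haar_measure R m) = cpow m"
  using sets_eq_imp_space_eq[OF Haar(1), of m] by (simp add: borel_of_topology_def space_measure_of_conv)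

lemma cpow_proj_image:
  assumes n: "n \<in> nonzero_ideals R"
  shows "cpow_proj m n ` cpow m = {..<m} \<rightarrow>\<^sub>E carrier (R Quot n)"
proof
  show "cpow_proj m n ` cpow m \<subseteq> {..<m} \<rightarrow>\<^sub>E carrier (R Quot n)"
    unfolding cpow_proj_def using completion_component[OF _ n] by (fastforce simp: PiE_iff)
  show "{..<m} \<rightarrow>\<^sub>E carrier (R Quot n) \<subseteq> cpow_proj m n ` cpow m"
  proof
    fix q assume q: "q \<in> {..<m} \<rightarrow>\<^sub>E carrier (R Quot n)"
    have "\<forall>i\<in>{..<m}. \<exists>a\<in>carrier R. q i = n +> a" using q by (auto simp: Quot_carrier PiE_iff)
    then obtain a where a: "\<And>i. i < m \<Longrightarrow> a i \<in> carrier R \<and> q i = n +> a i" by (metis lessThan_iff)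
    have "cpow_embed R m a \<in> cpow m" using a completion_embed_closed by (auto simp: cpow_embed_def)
    moreover have "cpow_proj m n (cpow_embed R m a) = q"
      using a q n by (auto simp: cpow_proj_def cpow_embed_def completion_embed_def PiE_iff extensional_def fun_eq_iff)
    ultimately show "q \<in> cpow_proj m n ` cpow m" by blast
  qed
qed

text \<open>The congruence classes modulo \<open>n\<close> are translates of one another, so they
  share one measure; as they partition a space of total mass 1, it is the reciprocal of their
  number.\<close>

lemma emeasure_preimage:
  assumes n: "n \<in> nonzero_ideals R" and T: "T \<subseteq> cpow_proj m n ` cpow m"
  shows "openin (cpow_topology R m) {y \<in> cpow m. cpow_proj m n y \<in> T}"
    and "emeasure (Haar_measure R m) {y \<in> cpow m. cpow_proj m n y \<in> T} =
      ennreal (real (card T) / real (card (carrier (R Quot n))) ^ m)"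
proof -
  let ?M = "Haar_measure R m"
  interpret finite_measure ?M using Haar(2)[of m] by (intro finite_measureI) simp
  define Q where "Q = cpow_proj m n ` cpow m"
  define E where "E q = {y \<in> cpow m. cpow_proj m n y = q}" for q
  have finQ: "finite Q" unfolding Q_def cpow_proj_image[OF n] using finite_Quot[OF n] by (simp add: finite_PiE)
  have cardQ: "card Q = card (carrier (R Quot n)) ^ m"
    unfolding Q_def cpow_proj_image[OF n] by (simp add: card_PiE)
  have openE: "openin (cpow_topology R m) (E q)" if "q \<in> Q" for q
    using that openin_fibre_cpow[OF n] unfolding Q_def E_def by blast
  have Eset: "E q \<in> sets ?M" if "q \<in> Q" for q using openin_Haar openE that by blast
  have same: "measure ?M (E q) = measure ?M (E r)" if qr: "q \<in> Q" "r \<in> Q" for q r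
  proof -
    obtain x y where x: "x \<in> cpow m" "q = cpow_proj m n x" and y: "y \<in> cpow m" "r = cpow_proj m n y"
      using qr unfolding Q_def by blast
    obtain a where a: "a \<in> cpow m" "translate m a x = y" using translate_transitive[OF x(1) y(1)] by blast
    have "translate m a ` E q = E r"
    proof (intro equalityI subsetI)
      fix z assume "z \<in> translate m a ` E q"
      then obtain w where w: "w \<in> cpow m" "cpow_proj m n w = q" "z = translate m a w" by (auto simp: E_def)
      have "cpow_proj m n z = r"
        using translate_equivariant[OF a(1) w(1) x(1) n] w x y a by simp
      then show "z \<in> E r" using translate_closed[OF a(1) w(1)] w by (simp add: E_def)
    next
      fix z assume z: "z \<in> E r"
      then have "z \<in> translate m a ` cpow m" unfolding translate_surj[OF a(1)] by (simp add: E_def)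
      then obtain w where w: "z = translate m a w" "w \<in> cpow m" by (rule imageE)
      have "cpow_proj m n w = q"
        using translate_equivariant[OF a(1) w(2) x(1) n] w x y a z by (simp add: E_def)
      then show "z \<in> translate m a ` E q" using w by (auto simp: E_def)
    qed
    then show ?thesis using Haar(3)[OF a(1) Eset[OF qr(1)]] by (simp add: measure_def)
  qed
  have union: "{y \<in> cpow m. cpow_proj m n y \<in> U} = (\<Union>q\<in>U. E q)" for U by (auto simp: E_def)
  have sum: "measure ?M {y \<in> cpow m. cpow_proj m n y \<in> U} = (\<Sum>q\<in>U. measure ?M (E q))" if U: "U \<subseteq> Q" for U
    unfolding union
  proof (rule finite_measure_finite_Union)
    show "finite U" using finite_subset[OF U finQ] .
    show "E ` U \<subseteq> sets ?M" using Eset U by blast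
    show "disjoint_family_on E U" by (auto simp: disjoint_family_on_def E_def)
  qed
  obtain q0 where q0: "q0 \<in> Q" using cpow_nonempty unfolding Q_def by blast
  define c where "c = measure ?M (E q0)"
  have sumc: "measure ?M {y \<in> cpow m. cpow_proj m n y \<in> U} = real (card U) * c" if U: "U \<subseteq> Q" for U
  proof -
    have "(\<Sum>q\<in>U. measure ?M (E q)) = (\<Sum>q\<in>U. c)"
      unfolding c_def by (rule sum.cong[OF refl]) (use same q0 U in blast)
    then show ?thesis using sum[OF U] by simp
  qed
  have "{y \<in> cpow m. cpow_proj m n y \<in> Q} = space ?M" unfolding space_Haar Q_def by blast
  then have "real (card Q) * c = 1" using sumc[of Q] Haar(2)[of m] by (simp add: measure_def)
  moreover have "real (card Q) \<noteq> 0" using q0 finQ by auto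
  ultimately have c: "c = 1 / real (card Q)" by (simp add: field_simps)
  show "openin (cpow_topology R m) {y \<in> cpow m. cpow_proj m n y \<in> T}"
    unfolding union using T openE by (intro openin_Union) (auto simp: Q_def)
  show "emeasure ?M {y \<in> cpow m. cpow_proj m n y \<in> T} =
      ennreal (real (card T) / real (card (carrier (R Quot n))) ^ m)"
    unfolding emeasure_eq_measure using sumc[of T] T c cardQ by (simp add: Q_def)
qed

end

section \<open>Comparison of procounting measures\<close>

context residually_finite_domain
begin

section \<open>The net of nonzero ideals\<close>

lemma carrier_nonzero_ideal: "carrier R \<in> nonzero_ideals R"
proof -
  have "carrier R \<noteq> {\<zero>}" using one_closed one_not_zero by (metis singletonD)
  then show ?thesis using oneideal by (simp add: nonzero_ideals_def)
qed

lemma ideal_prod_nonzero: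
  assumes "n \<in> nonzero_ideals R" "m \<in> nonzero_ideals R"
  shows "ideal_prod R n m \<in> nonzero_ideals R"
proof -
  obtain x where x: "x \<in> n" "x \<in> carrier R" "x \<noteq> \<zero>" using assms(1) by (rule nonzero_ideals_nonzero)
  obtain y where y: "y \<in> m" "y \<in> carrier R" "y \<noteq> \<zero>" using assms(2) by (rule nonzero_ideals_nonzero)
  have "x \<otimes> y \<in> ideal_prod R n m" using x y by (intro ideal_prod.prod)
  moreover have "x \<otimes> y \<noteq> \<zero>" using x y by (simp add: integral_iff)
  ultimately have "ideal_prod R n m \<noteq> {\<zero>}" by (metis singletonD)
  moreover have "ideal (ideal_prod R n m) R"
    by (rule ideal_prod_is_ideal[OF nonzero_ideals_ideal[OF assms(1)] nonzero_ideals_ideal[OF assms(2)]])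
  ultimately show ?thesis by (simp add: nonzero_ideals_def)
qed

lemma eventually_ideals_to_zero:
  assumes n: "n \<in> nonzero_ideals R"
  shows "eventually (\<lambda>l. l \<in> nonzero_ideals R \<and> l \<subseteq> n) (ideals_to_zero R)"
  unfolding ideals_to_zero_def
proof (rule eventually_INF1[OF n], unfold eventually_principal, intro ballI)
  fix l assume "l \<in> {l \<in> nonzero_ideals R. \<exists>j. ideal j R \<and> l = ideal_prod R n j}"
  then obtain j where j: "l \<in> nonzero_ideals R" "ideal j R" "l = ideal_prod R n j" by blast
  then show "l \<in> nonzero_ideals R \<and> l \<subseteq> n"
    using ideal_prod_inter[OF nonzero_ideals_ideal[OF n] j(2)] by auto
qed

text \<open>The net is directed, since a multiple of \<open>ideal_prod R a b\<close> is a multiple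
  of both factors, and each tail is nonempty because it contains its own index. Uniqueness of limits
  and passage of inequalities to the limit rest on this.\<close>

lemma ideals_to_zero_not_bot: "ideals_to_zero R \<noteq> bot"
proof
  let ?S = "\<lambda>n. {l \<in> nonzero_ideals R. \<exists>j. ideal j R \<and> l = ideal_prod R n j}"
  assume "ideals_to_zero R = bot"
  then have F: "eventually (\<lambda>_. False) (INF n\<in>nonzero_ideals R. principal (?S n))"
    by (simp add: ideals_to_zero_def eventually_False)
  have "\<exists>n\<in>nonzero_ideals R. eventually (\<lambda>_. False) (principal (?S n))"
  proof (subst eventually_INF_base[symmetric])
    show "nonzero_ideals R \<noteq> {}" using carrier_nonzero_ideal by blast
    show "\<exists>x\<in>nonzero_ideals R. principal (?S x) \<le> inf (principal (?S a)) (principal (?S b))"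
      if ab: "a \<in> nonzero_ideals R" "b \<in> nonzero_ideals R" for a b
    proof (intro bexI[of _ "ideal_prod R a b"] ideal_prod_nonzero ab)
      have "?S (ideal_prod R a b) \<subseteq> ?S a \<inter> ?S b"
      proof
        fix l assume "l \<in> ?S (ideal_prod R a b)"
        then obtain j where l: "l \<in> nonzero_ideals R" and j: "ideal j R" "l = ideal_prod R (ideal_prod R a b) j"
          by blast
        have a: "ideal a R" and b: "ideal b R" using ab nonzero_ideals_ideal by auto
        have "l = ideal_prod R a (ideal_prod R b j)" using ideal_prod_assoc[OF a b j(1)] j(2) by simp
        moreover have "l = ideal_prod R b (ideal_prod R a j)"
          using ideal_prod_assoc[OF b a j(1)] ideal_prod_commute[OF a b] j(2) by simp
        ultimately show "l \<in> ?S a \<inter> ?S b"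
          using l ideal_prod_is_ideal[OF a j(1)] ideal_prod_is_ideal[OF b j(1)] by blast
      qed
      then show "principal (?S (ideal_prod R a b)) \<le> inf (principal (?S a)) (principal (?S b))"
        by (simp only: inf_principal principal_le_iff)
    qed
  qed (rule F)
  then obtain n where n: "n \<in> nonzero_ideals R" "?S n = {}" unfolding eventually_principal by blast
  have "ideal_prod R n (carrier R) = n" using n(1) nonzero_ideals_ideal ideal_prod_one by blast
  then have "n \<in> ?S n" using n(1) oneideal by auto
  then show False using n(2) by blast
qed

section \<open>Masses given by the approximating measures\<close>

lemma emeasure_tilde:
  assumes "A \<noteq> {}" "n \<in> nonzero_ideals R" "A \<subseteq> cpow m" and C: "openin (cpow_topology R m) C"
  shows "emeasure (tilde_measure R m A n) C =
    ennreal (real (card (carrier (R Quot n))) ^ m / real (card (cpow_proj m n ` A))) *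
      emeasure (Haar_measure R m) ({y \<in> cpow m. cpow_proj m n y \<in> cpow_proj m n ` A} \<inter> C)"
proof -
  let ?S = "{y \<in> cpow m. cpow_proj m n y \<in> cpow_proj m n ` A}"
  let ?c = "ennreal (real (card (carrier (R Quot n))) ^ m / real (card (cpow_proj m n ` A)))"
  have S: "?S \<in> sets (Haar_measure R m)"
    using emeasure_preimage(1)[OF assms(2), of "cpow_proj m n ` A" m] assms(3) by (intro openin_Haar) blast
  have C': "C \<in> sets (Haar_measure R m)" using C by (rule openin_Haar)
  have "emeasure (tilde_measure R m A n) C =
      (\<integral>\<^sup>+x. ?c * indicator ?S x * indicator C x \<partial>Haar_measure R m)"
    unfolding tilde_measure_def topspace_cpow using assms(1) S C'
    by (simp add: emeasure_density)
  also have "\<dots> = (\<integral>\<^sup>+x. ?c * indicator (?S \<inter> C) x \<partial>Haar_measure R m)"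
    by (rule nn_integral_cong) (simp add: indicator_def)
  also have "\<dots> = ?c * emeasure (Haar_measure R m) (?S \<inter> C)"
    using S C' by (intro nn_integral_cmult_indicator) auto
  finally show ?thesis .
qed

lemma card_Quot_pos: "n \<in> nonzero_ideals R \<Longrightarrow> card (carrier (R Quot n)) > 0"
  using finite_Quot by (auto simp: card_gt_0_iff Quot_carrier)

lemma card_proj_pos:
  assumes "A \<noteq> {}" "n \<in> nonzero_ideals R" "A \<subseteq> cpow m"
  shows "card (cpow_proj m n ` A) > 0"
proof -
  have "finite (cpow_proj m n ` cpow m)"
    unfolding cpow_proj_image[OF assms(2)] using finite_Quot[OF assms(2)] by (simp add: finite_PiE)
  then have "finite (cpow_proj m n ` A)" using assms(3) by (meson finite_subset image_mono)
  then show ?thesis using assms(1) by (simp add: card_gt_0_iff)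
qed

text \<open>The index in the density cancels against the Haar measure of a class, so every residue
  class met by \<open>A\<close> carries the same mass, the reciprocal of the number of such classes.
  \<open>T\<close> selects classes that lie inside \<open>C\<close>.\<close>

lemma emeasure_tilde_ge:
  assumes T: "T \<noteq> {}" "T \<subseteq> cpow_proj m n ` A" and n: "n \<in> nonzero_ideals R" and A: "A \<subseteq> cpow m"
    and C: "openin (cpow_topology R m) C" and sub: "{y \<in> cpow m. cpow_proj m n y \<in> T} \<subseteq> C"
  shows "ennreal (real (card T) / real (card (cpow_proj m n ` A))) \<le> emeasure (tilde_measure R m A n) C"
proof -
  let ?q = "real (card (carrier (R Quot n))) ^ m"
  let ?E = "{y \<in> cpow m. cpow_proj m n y \<in> T}"
  let ?S = "{y \<in> cpow m. cpow_proj m n y \<in> cpow_proj m n ` A}"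
  have A0: "A \<noteq> {}" using T by blast
  have pr: "cpow_proj m n ` A \<subseteq> cpow_proj m n ` cpow m" using A by blast
  have q: "?q > 0" using card_Quot_pos[OF n] by simp
  have "ennreal (real (card T) / real (card (cpow_proj m n ` A))) =
      ennreal ((?q / real (card (cpow_proj m n ` A))) * (real (card T) / ?q))"
    using q by simp
  also have "\<dots> = ennreal (?q / real (card (cpow_proj m n ` A))) * ennreal (real (card T) / ?q)"
    by (rule ennreal_mult) auto
  also have "ennreal (real (card T) / ?q) = emeasure (Haar_measure R m) ?E"
    using emeasure_preimage(2)[OF n, of T m] T(2) pr by simp
  also have "ennreal (?q / real (card (cpow_proj m n ` A))) * emeasure (Haar_measure R m) ?E \<le>
      ennreal (?q / real (card (cpow_proj m n ` A))) * emeasure (Haar_measure R m) (?S \<inter> C)"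
  proof (rule mult_left_mono[OF emeasure_mono])
    show "?E \<subseteq> ?S \<inter> C" using T(2) sub by blast
    show "?S \<inter> C \<in> sets (Haar_measure R m)"
      using emeasure_preimage(1)[OF n pr] openin_Haar C by blast
  qed simp
  also have "\<dots> = emeasure (tilde_measure R m A n) C" using emeasure_tilde[OF A0 n A C] by simp
  finally show ?thesis .
qed

lemma emeasure_tilde_eq_0:
  assumes n: "n \<in> nonzero_ideals R" and A: "A \<subseteq> cpow m" and C: "openin (cpow_topology R m) C"
    and disj: "{y \<in> cpow m. cpow_proj m n y \<in> cpow_proj m n ` A} \<inter> C = {}"
  shows "emeasure (tilde_measure R m A n) C = 0"
proof (cases "A = {}")
  case True
  then show ?thesis by (simp add: tilde_measure_def)
next
  case False
  show ?thesis unfolding emeasure_tilde[OF False n A C] disj by simp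
qed

text \<open>If \<open>u\<close> vanished modulo \<open>p\<close>, reducing \<open>u v = 1\<close>
  there would give \<open>0 = 1\<close> in the quotient by a prime ideal, which is a domain.\<close>

lemma prime_coset_not_unit:
  assumes p: "p \<in> prime_elements R" and u: "u \<in> Units (completion R)"
  shows "u (PIdl p) \<noteq> \<zero>\<^bsub>R Quot PIdl p\<^esub>"
proof
  let ?n = "PIdl p"
  have pr: "primeideal ?n R" and pc: "p \<in> carrier R" and p0: "p \<noteq> \<zero>"
    using p by (auto simp: prime_elements_def ring_irreducible_def)
  interpret n: primeideal ?n R by fact
  interpret Q: domain "R Quot ?n" by (rule n.quotient_is_domain)
  have nI: "?n \<in> nonzero_ideals R" using pc p0 by (rule PIdl_nonzero)
  assume z: "u ?n = \<zero>\<^bsub>R Quot ?n\<^esub>"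
  obtain v where v: "v \<in> carrier (completion R)" "u \<otimes>\<^bsub>completion R\<^esub> v = \<one>\<^bsub>completion R\<^esub>"
    using u unfolding Units_def by blast
  have "(u \<otimes>\<^bsub>completion R\<^esub> v) ?n = \<one>\<^bsub>completion R\<^esub> ?n" unfolding v(2) ..
  then have "u ?n \<otimes>\<^bsub>R Quot ?n\<^esub> v ?n = \<one>\<^bsub>R Quot ?n\<^esub>" using nI by simp
  then show False using z Q.l_null[OF completion_component[OF v(1) nI]] Q.one_not_zero by simp
qed

text \<open>The limit attached to finitely many tuples of primes charges the neighbourhood
  \<open>y\<^sub>0 \<equiv> 0 (mod p)\<close> of one of them (or is zero), whereas a set of tuples of units avoids it.\<close>

lemma procounting_primes_units:
  assumes k: "k \<ge> 1" and A0: "finite A0" "A0 \<subseteq> {..<k} \<rightarrow>\<^sub>E prime_elements R"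
    and B: "B \<noteq> {}" "B \<subseteq> {..<k} \<rightarrow>\<^sub>E Units (completion R)"
    and A_lim: "procounting_measure R k (cpow_embed R k ` A0) \<nu>"
    and B_lim: "procounting_measure R k B \<nu>"
  shows False
proof -
  let ?A = "cpow_embed R k ` A0"
  have comp: "compact_space (cpow_topology R k)"
    using compact_completion by (simp add: compact_space_product_topology)
  have BC: "B \<subseteq> cpow k" using B(2) by (auto simp: Units_def PiE_iff)
  have AC: "?A \<subseteq> cpow k"
    unfolding cpow_embed_def
  proof (intro image_subsetI restrict_PiE_iff[THEN iffD2] ballI completion_embed_closed)
    fix a i assume "a \<in> A0" "i \<in> {..<k}"
    then have "a i \<in> prime_elements R" using A0(2) by (auto simp: PiE_iff)
    then show "a i \<in> carrier R" by (simp add: prime_elements_def)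
  qed
  have lim: "((\<lambda>n. emeasure (tilde_measure R k D n) C) \<longlongrightarrow> emeasure \<nu> C) (ideals_to_zero R)"
    if "procounting_measure R k D \<nu>" "compactin (cpow_topology R k) C" "openin (cpow_topology R k) C" for C D
    using that unfolding procounting_measure_def by blast
  show False
  proof (cases "A0 = {}")
    case True
    \<comment> \<open>The whole space is itself compact and open, so weak-* convergence controls the
      total mass.\<close>
    have C: "compactin (cpow_topology R k) (cpow k)" "openin (cpow_topology R k) (cpow k)"
      using comp openin_topspace[of "cpow_topology R k"] by (simp_all only: compact_space_def topspace_cpow)
    have "((\<lambda>n. 0) \<longlongrightarrow> emeasure \<nu> (cpow k)) (ideals_to_zero R)"
      using lim[OF A_lim C] True by (simp add: tilde_measure_def)
    then have zero: "emeasure \<nu> (cpow k) = 0"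
      using tendsto_unique[OF ideals_to_zero_not_bot _ tendsto_const] by blast
    from eventually_ideals_to_zero[OF carrier_nonzero_ideal]
    have "\<forall>\<^sub>F n in ideals_to_zero R. 1 \<le> emeasure (tilde_measure R k B n) (cpow k)"
    proof eventually_elim
      case (elim n)
      have "ennreal (real (card (cpow_proj k n ` B)) / real (card (cpow_proj k n ` B))) \<le>
          emeasure (tilde_measure R k B n) (cpow k)"
        by (rule emeasure_tilde_ge) (use B BC C elim in auto)
      moreover have "card (cpow_proj k n ` B) > 0" using card_proj_pos[OF B(1) _ BC] elim by blast
      ultimately show ?case by simp
    qed
    from tendsto_lowerbound[OF lim[OF B_lim C] this ideals_to_zero_not_bot]
    show False using zero by simp
  next
    case False
    then obtain a where a: "a \<in> A0" by blast
    define n0 where "n0 = PIdl (a 0)"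
    have ap: "a 0 \<in> prime_elements R" using a A0(2) k by (auto simp: PiE_iff)
    then have pc: "a 0 \<in> carrier R" "a 0 \<noteq> \<zero>" by (auto simp: prime_elements_def ring_irreducible_def)
    have n0: "n0 \<in> nonzero_ideals R" unfolding n0_def using pc by (rule PIdl_nonzero)
    have a_zero: "completion_embed R (a 0) n0 = \<zero>\<^bsub>R Quot n0\<^esub>"
      using n0 a_rcos_zero[OF nonzero_ideals_ideal[OF n0]] cgenideal_self[OF pc(1)]
      by (simp add: completion_embed_def n0_def FactRing_def)
    define T where "T = {t \<in> cpow_proj k n0 ` cpow k. t 0 = \<zero>\<^bsub>R Quot n0\<^esub>}"
    define U where "U = {y \<in> cpow k. cpow_proj k n0 y \<in> T}"
    have U_iff: "y \<in> U \<longleftrightarrow> y \<in> cpow k \<and> y 0 n0 = \<zero>\<^bsub>R Quot n0\<^esub>" for y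
      using k by (auto simp: U_def T_def cpow_proj_def)
    have openU: "openin (cpow_topology R k) U"
      unfolding U_def by (rule emeasure_preimage(1)[OF n0]) (auto simp: T_def)
    \<comment> \<open>The complement of \<open>U\<close> is also a union of classes modulo
      \<open>n0\<close>. So \<open>U\<close> is clopen, hence compact, and is an admissible test set
      for both limits.\<close>
    have "openin (cpow_topology R k) {y \<in> cpow k. cpow_proj k n0 y \<in> cpow_proj k n0 ` cpow k - T}"
      by (rule emeasure_preimage(1)[OF n0]) auto
    moreover have "{y \<in> cpow k. cpow_proj k n0 y \<in> cpow_proj k n0 ` cpow k - T} = cpow k - U"
      by (auto simp: U_def)
    ultimately have "closedin (cpow_topology R k) U"
      unfolding closedin_def topspace_cpow by (auto simp: U_def)
    then have compactU: "compactin (cpow_topology R k) U" using comp closedin_compact_space by blast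
    have "\<forall>\<^sub>F n in ideals_to_zero R. emeasure (tilde_measure R k B n) U = 0"
      using eventually_ideals_to_zero[OF n0]
    proof eventually_elim
      case (elim n)
      show ?case
      proof (rule emeasure_tilde_eq_0)
        show "{y \<in> cpow k. cpow_proj k n y \<in> cpow_proj k n ` B} \<inter> U = {}"
        proof (intro equals0I)
          fix y assume y: "y \<in> {y \<in> cpow k. cpow_proj k n y \<in> cpow_proj k n ` B} \<inter> U"
          then obtain b where b: "b \<in> B" "cpow_proj k n y = cpow_proj k n b" by blast
          have b0: "b 0 \<in> Units (completion R)" using b(1) B(2) k by (auto simp: PiE_iff)
          have "y 0 n = b 0 n" using b(2) k by (auto simp: cpow_proj_eq_iff)
          moreover have "y 0 \<in> carrier (completion R)" "b 0 \<in> carrier (completion R)"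
            using y b(1) BC k by (auto simp: PiE_iff)
          \<comment> \<open>Eventually \<open>n\<close> lies inside \<open>n0\<close>, and then
            agreement modulo \<open>n\<close> implies agreement modulo \<open>n0\<close>.\<close>
          ultimately have "y 0 n0 = b 0 n0" using completion_agree[of "y 0" "b 0" n n0] elim n0 by blast
          then show False using y prime_coset_not_unit[OF ap b0] by (simp add: U_iff n0_def)
        qed
      qed (use elim BC openU in auto)
    qed
    from tendsto_eventually[OF this] have "emeasure \<nu> U = 0"
      by (rule tendsto_unique[OF ideals_to_zero_not_bot lim[OF B_lim compactU openU]])
    moreover have "\<forall>\<^sub>F n in ideals_to_zero R. ennreal (1 / real (card A0)) \<le> emeasure (tilde_measure R k ?A n) U"
      using eventually_ideals_to_zero[OF n0]
    proof eventually_elim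
      case (elim n)
      let ?x = "cpow_embed R k a"
      have xc: "?x \<in> cpow k" using a AC by blast
      have "ennreal (real (card {cpow_proj k n ?x}) / real (card (cpow_proj k n ` ?A))) \<le>
          emeasure (tilde_measure R k ?A n) U"
      proof (rule emeasure_tilde_ge)
        show "{y \<in> cpow k. cpow_proj k n y \<in> {cpow_proj k n ?x}} \<subseteq> U"
        proof
          fix y assume y: "y \<in> {y \<in> cpow k. cpow_proj k n y \<in> {cpow_proj k n ?x}}"
          have "y 0 n = ?x 0 n" using y k by (auto simp: cpow_proj_eq_iff)
          moreover have "y 0 \<in> carrier (completion R)" "?x 0 \<in> carrier (completion R)"
            using y xc k by (auto simp: PiE_iff)
          ultimately have "y 0 n0 = ?x 0 n0" using completion_agree[of "y 0" "?x 0" n n0] elim n0 by blast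
          also have "\<dots> = \<zero>\<^bsub>R Quot n0\<^esub>" using a_zero k by (simp add: cpow_embed_def)
          finally show "y \<in> U" using y by (simp add: U_iff)
        qed
      qed (use a elim AC openU in auto)
      then have ge: "ennreal (1 / real (card (cpow_proj k n ` ?A))) \<le> emeasure (tilde_measure R k ?A n) U"
        by simp
      \<comment> \<open>The number of classes of \<open>?A\<close> varies with \<open>n\<close>;
        replacing it by \<open>card A0\<close> gives a positive lower bound that is constant along
        the net.\<close>
      have "ennreal (1 / real (card A0)) \<le> ennreal (1 / real (card (cpow_proj k n ` ?A)))"
      proof (rule ennreal_leI, rule divide_left_mono)
        show "real (card (cpow_proj k n ` ?A)) \<le> real (card A0)"
          unfolding image_image using card_image_le[OF A0(1)] by simp
        show "0 < real (card A0) * real (card (cpow_proj k n ` ?A))"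
          using card_proj_pos[of ?A n k] False A0(1) AC elim by (simp add: card_gt_0_iff)
      qed simp
      then show ?case using ge by (rule order_trans)
    qed
    then have "ennreal (1 / real (card A0)) \<le> emeasure \<nu> U"
      by (rule tendsto_lowerbound[OF lim[OF A_lim compactU openU] _ ideals_to_zero_not_bot])
    moreover have "0 < 1 / real (card A0)" using False A0(1) by (simp add: card_gt_0_iff)
    ultimately show False by simp
  qed
qed

end

section \<open>Polynomials on the completion\<close>

text \<open>Here the operations of \<open>R\<close> are those of the ambient field restricted to
  \<open>D\<close>, so \<open>poly\<close> and ordinary sums over the type compute in
  \<open>R\<close>.\<close>

locale residually_finite_subring = residually_finite_domain R for R :: "'a::field ring" (structure) +
  fixes D :: "'a set"
  assumes R_def: "R = field_ring\<lparr>carrier := D\<rparr>"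
begin

lemma R_simps: "carrier R = D" "x \<oplus> y = x + y" "x \<otimes> y = x * y" "\<zero> = 0" "\<one> = 1"
  by (simp_all add: R_def)

lemma sum_mem:
  fixes d :: nat
  assumes "\<And>i. t i \<in> D"
  shows "(\<Sum>i\<le>d. t i) \<in> D"
  using assms a_closed by (induction d) (auto simp: R_simps)

lemma pow_component:
  fixes i :: nat
  assumes x: "x \<in> carrier (completion R)" and n: "n \<in> nonzero_ideals R" and a: "a \<in> D" "x n = n +> a"
  shows "x [^]\<^bsub>completion R\<^esub> i \<in> carrier (completion R)" "a ^ i \<in> D"
    "(x [^]\<^bsub>completion R\<^esub> i) n = n +> (a ^ i)"
proof -
  interpret C: cring "completion R" by (rule completion_cring)
  show "x [^]\<^bsub>completion R\<^esub> i \<in> carrier (completion R)" using x by (rule C.nat_pow_closed)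
  show pD: "a ^ i \<in> D" for i
    using a one_closed m_closed by (induction i) (auto simp: R_simps)
  show "(x [^]\<^bsub>completion R\<^esub> i) n = n +> (a ^ i)"
  proof (induction i)
    case 0
    show ?case using n Quot_one_zero(1)[OF nonzero_ideals_ideal[OF n]] by (simp add: R_simps)
  next
    case (Suc i)
    have "(x [^]\<^bsub>completion R\<^esub> Suc i) n = (n +> (a ^ i)) \<otimes>\<^bsub>R Quot n\<^esub> (n +> a)"
      using n a Suc by (simp add: C.nat_pow_Suc)
    also have "\<dots> = n +> (a ^ i \<otimes> a)"
      using Quot_ops(2)[OF nonzero_ideals_ideal[OF n]] pD a by (simp add: R_simps)
    finally show ?case by (simp add: R_simps mult.commute)
  qed
qed

text \<open>Evaluation commutes with reduction: modulo \<open>n\<close>, the point \<open>x\<close>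
  may be replaced by a representative \<open>a\<close> in \<open>D\<close>. Identities between
  polynomial maps on the completion thus follow from identities of values in
  \<open>D\<close>.\<close>

lemma poly_completion_component:
  assumes x: "x \<in> carrier (completion R)" and n: "n \<in> nonzero_ideals R" and a: "a \<in> D" "x n = n +> a"
    and f: "\<And>i. poly.coeff f i \<in> D"
  shows "poly_completion R f x \<in> carrier (completion R)" "poly_completion R f x n = n +> poly f a"
proof -
  interpret C: cring "completion R" by (rule completion_cring)
  define t where "t i = completion_embed R (poly.coeff f i) \<otimes>\<^bsub>completion R\<^esub> x [^]\<^bsub>completion R\<^esub> i" for i :: nat
  have t: "t i \<in> carrier (completion R)" for i
    unfolding t_def using pow_component(1)[OF x n a] completion_embed_closed f
    by (intro completion_closed(2)) (auto simp: R_simps)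
  have fa: "poly.coeff f i * a ^ i \<in> D" for i
    using m_closed[of "poly.coeff f i" "a ^ i"] f pow_component(2)[OF x n a] by (simp add: R_simps)
  have tn: "t i n = n +> (poly.coeff f i * a ^ i)" for i
    using Quot_ops(2)[OF nonzero_ideals_ideal[OF n], of "poly.coeff f i" "a ^ i"] f n
      pow_component(2,3)[OF x n a]
    by (simp add: t_def completion_embed_def R_simps)
  have sumD: "(\<Sum>i\<le>d. poly.coeff f i * a ^ i) \<in> D" for d
    using fa by (rule sum_mem)
  have sum: "(finsum (completion R) t {..d}) n = n +> (\<Sum>i\<le>d. poly.coeff f i * a ^ i)" for d
  proof (induction d)
    case 0
    have "finsum (completion R) t {..0} = t 0" using t by (intro C.finsum_0) auto
    then show ?case by (simp only: tn) simp
  next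
    case (Suc d)
    have "finsum (completion R) t {..Suc d} = t (Suc d) \<oplus>\<^bsub>completion R\<^esub> finsum (completion R) t {..d}"
      using t by (intro C.finsum_Suc) auto
    then have "(finsum (completion R) t {..Suc d}) n =
        (n +> (poly.coeff f (Suc d) * a ^ Suc d)) \<oplus>\<^bsub>R Quot n\<^esub> (n +> (\<Sum>i\<le>d. poly.coeff f i * a ^ i))"
      using n Suc tn by simp
    also have "\<dots> = n +> (poly.coeff f (Suc d) * a ^ Suc d \<oplus> (\<Sum>i\<le>d. poly.coeff f i * a ^ i))"
      by (rule Quot_ops(1)[OF nonzero_ideals_ideal[OF n]]) (use fa[of "Suc d"] sumD in \<open>simp_all add: R_simps\<close>)
    finally show ?case by (simp add: R_simps add.commute)
  qed
  have eq: "poly_completion R f x = finsum (completion R) t {..Polynomial.degree f}"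
    unfolding poly_completion_def t_def ..
  show "poly_completion R f x \<in> carrier (completion R)"
    unfolding eq using t by (intro C.finsum_closed) auto
  show "poly_completion R f x n = n +> poly f a"
    unfolding eq sum poly_altdef ..
qed

lemma poly_completion_closed:
  assumes x: "x \<in> carrier (completion R)" and f: "\<And>i. poly.coeff f i \<in> D"
  shows "poly_completion R f x \<in> carrier (completion R)"
proof -
  \<comment> \<open>The unit ideal serves as a level at which a representative exists, as the
    component lemma expects one.\<close>
  have "x (carrier R) \<in> carrier (R Quot carrier R)" by (rule completion_component[OF x carrier_nonzero_ideal])
  then obtain a where a: "a \<in> D" "x (carrier R) = carrier R +> a" by (auto simp: Quot_carrier R_simps)
  show ?thesis by (rule poly_completion_component(1)[OF x carrier_nonzero_ideal a f])
qed

lemma poly_mem: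
  assumes f: "\<And>i. poly.coeff f i \<in> D" and a: "a \<in> D"
  shows "poly f a \<in> D"
proof -
  have "a ^ i \<in> D" for i using a one_closed m_closed by (induction i) (auto simp: R_simps)
  then have "poly.coeff f i * a ^ i \<in> D" for i using f m_closed by (auto simp: R_simps)
  then have "(\<Sum>i\<le>d. poly.coeff f i * a ^ i) \<in> D" for d by (rule sum_mem)
  then show ?thesis by (simp add: poly_altdef)
qed

lemma coeff_mult_mem:
  assumes f: "\<And>i. poly.coeff f i \<in> D" and g: "\<And>i. poly.coeff g i \<in> D"
  shows "poly.coeff (f * g) i \<in> D"
proof -
  have "poly.coeff f j * poly.coeff g (i - j) \<in> D" for j
    using f g m_closed by (auto simp: R_simps)
  then have "(\<Sum>j\<le>d. poly.coeff f j * poly.coeff g (i - j)) \<in> D" for d by (rule sum_mem)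
  then show ?thesis by (simp add: coeff_mult)
qed

lemma coeff_prod_mem:
  assumes "finite I" "\<And>i j. i \<in> I \<Longrightarrow> poly.coeff (f i) j \<in> D"
  shows "poly.coeff (\<Prod>i\<in>I. f i) j \<in> D"
  using assms
proof (induction I arbitrary: j)
  case empty
  show ?case using one_closed zero_closed by (auto simp: R_simps one_pCons coeff_pCons split: nat.split)
next
  case (insert i I)
  then show ?case using coeff_mult_mem by simp
qed

lemma poly_completion_mult:
  assumes x: "x \<in> carrier (completion R)"
    and f: "\<And>i. poly.coeff f i \<in> D" and g: "\<And>i. poly.coeff g i \<in> D"
  shows "poly_completion R (f * g) x = poly_completion R f x \<otimes>\<^bsub>completion R\<^esub> poly_completion R g x"
proof (rule completion_eqI)
  show "poly_completion R (f * g) x \<in> carrier (completion R)"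
    using poly_completion_closed[OF x coeff_mult_mem[OF f g]] .
  show "poly_completion R f x \<otimes>\<^bsub>completion R\<^esub> poly_completion R g x \<in> carrier (completion R)"
    by (rule completion_closed(2)[OF poly_completion_closed[OF x f] poly_completion_closed[OF x g]])
  fix n assume n: "n \<in> nonzero_ideals R"
  have "x n \<in> carrier (R Quot n)" by (rule completion_component[OF x n])
  then obtain a where a: "a \<in> D" "x n = n +> a" by (auto simp: Quot_carrier R_simps)
  show "poly_completion R (f * g) x n = (poly_completion R f x \<otimes>\<^bsub>completion R\<^esub> poly_completion R g x) n"
    using poly_completion_component(2)[OF x n a f] poly_completion_component(2)[OF x n a g]
      poly_completion_component(2)[OF x n a coeff_mult_mem[OF f g]] n
      Quot_ops(2)[OF nonzero_ideals_ideal[OF n], of "poly f a" "poly g a"] poly_mem[OF f a(1)] poly_mem[OF g a(1)]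
    by (simp add: R_simps)
qed

text \<open>Evaluation is multiplicative, and in a commutative ring a factor of a unit is a unit. A
  single point with unit value of the product is therefore a point where the whole tuple consists of
  units.\<close>

lemma poly_completion_unit_factor:
  fixes k :: nat
  assumes x: "x \<in> carrier (completion R)" and f: "\<And>i j. i < k \<Longrightarrow> poly.coeff (f i) j \<in> D"
    and u: "poly_completion R (\<Prod>i<k. f i) x \<in> Units (completion R)" and i: "i < k"
  shows "poly_completion R (f i) x \<in> Units (completion R)"
proof -
  interpret C: cring "completion R" by (rule completion_cring)
  define g where "g = (\<Prod>j\<in>{..<k} - {i}. f j)"
  have g: "poly.coeff g j \<in> D" for j unfolding g_def by (rule coeff_prod_mem) (use f in auto)
  have "(\<Prod>i<k. f i) = f i * g" unfolding g_def using i by (intro prod.remove) auto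
  then have "poly_completion R (f i) x \<otimes>\<^bsub>completion R\<^esub> poly_completion R g x \<in> Units (completion R)"
    using u poly_completion_mult[OF x f[OF i] g] by simp
  then show ?thesis
    by (rule C.unit_factor) (use poly_completion_closed[OF x] f[OF i] g in auto)
qed

theorem Schinzel_of_Bateman_Horn:
  assumes BH: "profinite_Bateman_Horn R"
  shows "extended_Schinzel R"
  unfolding extended_Schinzel_def
proof (intro allI impI)
  fix k :: nat and f assume k: "k \<ge> 1" and adm: "admissible_polys R k f \<and> locally_unit_valued R k f"
  let ?A = "poly_map k f ` carrier R \<inter> ({..<k} \<rightarrow>\<^sub>E prime_elements R)"
  let ?B = "poly_map_completion R k f ` carrier (completion R) \<inter> ({..<k} \<rightarrow>\<^sub>E Units (completion R))"
  have fD: "poly.coeff (f i) j \<in> D" if "i < k" for i j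
    using adm that unfolding admissible_polys_def polynomials_over_def by (auto simp: R_simps)
  obtain x where x: "x \<in> carrier (completion R)" "poly_completion R (\<Prod>i<k. f i) x \<in> Units (completion R)"
    using adm unfolding locally_unit_valued_def by blast
  have "poly_map_completion R k f x \<in> ?B"
    using x(1) poly_completion_unit_factor[OF x(1) fD x(2)] by (auto simp: poly_map_completion_def)
  then have B: "?B \<noteq> {}" by blast
  obtain \<nu> where "procounting_measure R k (cpow_embed R k ` ?A) \<nu>" "procounting_measure R k ?B \<nu>"
    using BH k adm unfolding profinite_Bateman_Horn_def by blast
  then show "infinite ?A"
    using procounting_primes_units[OF k _ _ B] by blast
qed

end

section \<open>Application to rings of S-integers\<close>

lemma finite_Quot_of_filtered_lattice:
  fixes D :: "'a::field set"
  assumes A: "filtered_lattice (A :: nat \<Rightarrow> 'a set) c m e"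
    and D: "subring D field_ring" and n: "n \<in> nonzero_ideals (field_ring\<lparr>carrier := D\<rparr>)"
  shows "finite (carrier (field_ring\<lparr>carrier := D\<rparr> Quot n))"
proof (rule ccontr)
  let ?R = "field_ring\<lparr>carrier := D\<rparr>"
  interpret F: field "field_ring :: 'a ring" by (rule field_from_type_algebra)
  interpret D: subring D field_ring by (rule D)
  interpret R: domain ?R using F.subdomain_iff[of D] F.subdomainI'[OF D] by simp
  interpret n: ideal n ?R using n by (rule R.nonzero_ideals_ideal)
  obtain x where x: "x \<in> n" "x \<in> carrier ?R" "x \<noteq> \<zero>\<^bsub>?R\<^esub>" using n by (rule R.nonzero_ideals_nonzero)
  have minus: "y - z \<in> D" if "y \<in> D" "z \<in> D" for y z
  proof -
    have "y \<oplus>\<^bsub>field_ring\<^esub> \<ominus>\<^bsub>field_ring\<^esub> z \<in> D" using that subringE(5,7)[OF D] by blast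
    then show ?thesis by simp
  qed
  have D_ops: "0 \<in> D" "\<And>y z. y \<in> D \<Longrightarrow> z \<in> D \<Longrightarrow> y + z \<in> D" "\<And>y z. y \<in> D \<Longrightarrow> z \<in> D \<Longrightarrow> y * z \<in> D"
    using subringE(2,6,7)[OF D] by simp_all
  have xD: "x \<in> D" "x \<noteq> 0" using x by simp_all
  obtain K where K: "\<forall>Y. finite Y \<and> Y \<subseteq> D \<and>
      (\<forall>y\<in>Y. \<forall>z\<in>Y. \<forall>d\<in>D. y - z = x * d \<longrightarrow> y = z) \<longrightarrow> card Y \<le> K"
    using filtered_lattice.bounded_residues[OF A D_ops(1,2) minus D_ops(3) xD] by (rule exE)
  assume "infinite (carrier (?R Quot n))"
  \<comment> \<open>An infinite quotient would supply \<open>K + 1\<close> distinct cosets, one more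
    than \<open>bounded_residues\<close> permits.\<close>
  then obtain T where T: "finite T" "card T = Suc K" "T \<subseteq> carrier (?R Quot n)"
    by (meson infinite_arbitrarily_large)
  have "\<forall>q\<in>T. \<exists>a\<in>D. q = n +>\<^bsub>?R\<^esub> a" using T(3) by (auto simp: R.Quot_carrier)
  then obtain h where h: "\<And>q. q \<in> T \<Longrightarrow> h q \<in> D \<and> q = n +>\<^bsub>?R\<^esub> h q" by metis
  have inj: "inj_on h T" by (rule inj_onI) (metis h)
  have "card (h ` T) \<le> K"
  proof (rule K[rule_format], intro conjI)
    show "finite (h ` T)" "h ` T \<subseteq> D" using T(1) h by auto
    show "\<forall>y\<in>h ` T. \<forall>z\<in>h ` T. \<forall>d\<in>D. y - z = x * d \<longrightarrow> y = z"
    proof (intro ballI impI)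
      fix y z d assume y: "y \<in> h ` T" and z: "z \<in> h ` T" and d: "d \<in> D" "y - z = x * d"
      obtain p q where p: "p \<in> T" "y = h p" and q: "q \<in> T" "z = h q" using y z by blast
      have zD: "z \<in> D" using q h by blast
      \<comment> \<open>The ideal contains all multiples of \<open>x\<close>, so representatives
        congruent modulo \<open>x\<close> lie in the same coset of \<open>n\<close>.\<close>
      have "x * d \<in> n" using n.I_r_closed[OF x(1), of d] d(1) by simp
      moreover have "y = x * d + z" using d(2) by (simp add: algebra_simps)
      ultimately have "y \<in> n +>\<^bsub>?R\<^esub> z" by (auto simp: a_r_coset_def')
      then have "n +>\<^bsub>?R\<^esub> z = n +>\<^bsub>?R\<^esub> y" using zD by (intro n.a_repr_independence') simp_all
      then have "p = q" using h p q by metis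
      then show "y = z" using p q by simp
    qed
  qed
  then show False using T(2) card_image[OF inj] by simp
qed

text \<open>All archimedean places lie in \<open>S\<close>, so the absolute values in the definition
  satisfy the ultrametric inequality, and their closed unit balls are closed under addition as well
  as multiplication.\<close>

lemma S_integers_subring:
  assumes "archimedean_places \<subseteq> (S :: ('a::field \<Rightarrow> real) set set)"
  shows "subring {x. \<forall>P\<in>places - S. \<forall>v\<in>P. v x \<le> 1} field_ring"
proof -
  interpret F: field "field_ring :: 'a ring" by (rule field_from_type_algebra)
  let ?D = "{x :: 'a. \<forall>P\<in>places - S. \<forall>v\<in>P. v x \<le> 1}"
  have v: "absolute_value v \<and> (\<forall>x y. v (x + y) \<le> max (v x) (v y))" if "P \<in> places - S" "v \<in> P" for P v
  proof -
    have "P \<notin> archimedean_places" using that assms by blast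
    then have "\<forall>x y. v (x + y) \<le> max (v x) (v y)" using that by (auto simp: archimedean_places_def)
    moreover have "absolute_value v" using that by (auto simp: places_def nontrivial_absolute_value_def)
    ultimately show ?thesis by blast
  qed
  have one: "v 1 = 1" if "absolute_value v" for v :: "'a \<Rightarrow> real"
  proof -
    have "v 1 * v 1 = v 1 * 1" "v 1 \<noteq> 0"
      using that unfolding absolute_value_def by (metis mult.right_neutral, metis zero_neq_one)
    then show ?thesis by simp
  qed
  have neg: "v (- x) = v x" if a: "absolute_value v" for v :: "'a \<Rightarrow> real" and x
  proof -
    have mult: "v (y * z) = v y * v z" and nonneg: "0 \<le> v y" for y z
      using a unfolding absolute_value_def by blast+
    \<comment> \<open>\<open>v (- 1)\<close> is a nonnegative real with square 1, hence 1.\<close>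
    have "v (- 1) * v (- 1) = 1" using mult[of "- 1" "- 1"] one[OF a] by simp
    then have "v (- 1) = 1" using nonneg[of "- 1"] by (metis abs_of_nonneg abs_1 power2_eq_square real_sqrt_abs real_sqrt_one)
    then show ?thesis using mult[of "- 1" x] by simp
  qed
  show ?thesis
  proof (rule F.subringI)
    show "\<one>\<^bsub>field_ring\<^esub> \<in> ?D" using v one by fastforce
    show "\<ominus>\<^bsub>field_ring\<^esub> h \<in> ?D" if "h \<in> ?D" for h using that v neg by fastforce
    show "h1 \<otimes>\<^bsub>field_ring\<^esub> h2 \<in> ?D" if "h1 \<in> ?D" "h2 \<in> ?D" for h1 h2
    proof -
      have "w (h1 * h2) \<le> 1" if P: "P \<in> places - S" "w \<in> P" for P w
      proof -
        have "absolute_value w" using v[OF P] by blast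
        then have "w (h1 * h2) = w h1 * w h2" "0 \<le> w h1" "0 \<le> w h2" unfolding absolute_value_def by blast+
        moreover have "w h1 \<le> 1" "w h2 \<le> 1" using P \<open>h1 \<in> ?D\<close> \<open>h2 \<in> ?D\<close> by blast+
        ultimately show ?thesis by (simp add: mult_le_one)
      qed
      then show ?thesis by simp
    qed
    show "h1 \<oplus>\<^bsub>field_ring\<^esub> h2 \<in> ?D" if "h1 \<in> ?D" "h2 \<in> ?D" for h1 h2
    proof -
      have "w (h1 + h2) \<le> 1" if P: "P \<in> places - S" "w \<in> P" for P w
      proof -
        have "w (h1 + h2) \<le> max (w h1) (w h2)" using v[OF P] by blast
        moreover have "w h1 \<le> 1" "w h2 \<le> 1" using P \<open>h1 \<in> ?D\<close> \<open>h2 \<in> ?D\<close> by blast+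
        ultimately show ?thesis by simp
      qed
      then show ?thesis by simp
    qed
  qed simp
qed

theorem proposition3p26:
  fixes S :: "('a::field \<Rightarrow> real) set set"
  assumes "global_field TYPE('a)"
    and "CHAR('a) \<noteq> 2"
    and "finite S" and "S \<noteq> {}" and "S \<subseteq> places" and "archimedean_places \<subseteq> S"
    and "profinite_Bateman_Horn (S_integers S)"
  shows "extended_Schinzel (S_integers S)"
proof -
  define D where "D = {x :: 'a. \<forall>P\<in>places - S. \<forall>v\<in>P. v x \<le> 1}"
  obtain A c m e where A: "filtered_lattice (A :: nat \<Rightarrow> 'a set) c m e"
    using global_field_filtered_lattice[OF assms(1)] by blast
  have D: "subring D field_ring" unfolding D_def using assms(6) by (rule S_integers_subring)
  interpret F: field "field_ring :: 'a ring" by (rule field_from_type_algebra)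
  have dom: "domain (field_ring\<lparr>carrier := D\<rparr>)"
    using F.subdomain_iff[of D] F.subdomainI'[OF D] by simp
  have S: "S_integers S = field_ring\<lparr>carrier := D\<rparr>" by (simp add: S_integers_def D_def)
  have "residually_finite_subring (S_integers S) D"
  proof (intro residually_finite_subring.intro residually_finite_domain.intro
      residually_finite_domain_axioms.intro residually_finite_subring_axioms.intro)
    show "domain (S_integers S)" unfolding S by (rule dom)
    show "finite (carrier (S_integers S Quot n))" if "n \<in> nonzero_ideals (S_integers S)" for n
      using finite_Quot_of_filtered_lattice[OF A D] that unfolding S .
    show "countable (carrier (S_integers S))"
      by (rule countable_subset[OF subset_UNIV filtered_lattice.countable_UNIV[OF A]])
  qed (rule S)
  then interpret residually_finite_subring "S_integers S" D .
  show ?thesis using assms(7) by (rule Schinzel_of_Bateman_Horn)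
qed

end
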